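(* For each positive integer $n$, the map $\widehat{\Lambda\!\Lambda}_n:\mathrm{VHC}(\operatorname{Av}_n(312))\to\operatorname{Int}(\mathcal M_{n-1}^C)$ defined in the context below is well defined and is a bijection. In particular, $|\mathrm{VHC}(\operatorname{Av}_n(312))|=|\operatorname{Int}(\mathcal M_{n-1}^C)|$.
   Context: Permutations and patterns. $S_n$ is the set of permutations of $[n]=\{1,\dots,n\}$, written as words $\pi=\pi_1\cdots\pi_n$. A permutation $\pi$ contains a pattern $\tau\in S_m$ if some subsequence $\pi_{i_1}\cdots\pi_{i_m}$ ($i_1<\cdots<i_m$) has the same relative order as $\tau$; otherwise $\pi$ avoids $\tau$. $\operatorname{Av}_n(\tau^{(1)},\dots,\tau^{(r)})$ is the set of permutations in $S_n$ avoiding all of $\tau^{(1)},\dots,\tau^{(r)}$. Valid hook configurations. The plot of $\pi$ is the set of points $(i,\pi_i)$. A descent of $\pi$ is an index $i\in[n-1]$ with $\pi_i>\pi_{i+1}$; then $(i,\pi_i)$ is a descent top. A hook of $\pi$ is determined by indices $i<j$ with $\pi_i<\pi_j$: it is drawn as the vertical segment from $(i,\pi_i)$ up to $(i,\pi_j)$ followed by the horizontal segment from $(i,\pi_j)$ to $(j,\pi_j)$; $(i,\pi_i)$ is its southwest endpoint and $(j,\pi_j)$ its northeast endpoint. If $\pi$ has descents $d_1<\cdots<d_k$, a valid hook configuration of $\pi$ is a tuple $(H_1,\dots,H_k)$ of hooks of $\pi$ such that: (1) for each $i\in[k]$ the southwest endpoint of $H_i$ is $(d_i,\pi_{d_i})$;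 (2) no point of the plot of $\pi$ lies directly above a hook; (3) hooks do not intersect or overlap each other, except that the northeast endpoint of one hook may be the southwest endpoint of another. $\mathrm{VHC}(\pi)$ is the set of valid hook configurations of $\pi$; a valid hook configuration includes its underlying permutation as part of its data (so $\mathrm{VHC}(\pi)\cap\mathrm{VHC}(\pi')=\emptyset$ for $\pi\ne\pi'$), and every increasing permutation (including the empty one) has exactly one valid hook configuration (with no hooks). For a set $A$ of permutations, $\mathrm{VHC}(A)=\bigcup_{\pi\in A}\mathrm{VHC}(\pi)$. Motzkin paths and posets. A Motzkin path of length $n$ is a word over $\{U,D,E\}$ of length $n$ with equally many $U$'s and $D$'s such that every prefix has at least as many $U$'s as $D$'s; ${\bf M}_n$ is the set of these. Every $\Lambda\in{\bf M}_n$ can be written uniquely as $X_1D^{\gamma_1}X_2D^{\gamma_2}\cdots X_mD^{\gamma_m}$ with $X_j\in\{U,E\}$ and $\gamma_j\ge 0$; the class of $\Lambda$ is $\mathrm{cl}(\Lambda)=\{j: X_j=E\}$. For $\Lambda,\Lambda'\in{\bf M}_n$, $\Lambda\le_S\Lambda'$ means that for every $i\in[n]$ the number of $U$'s among the first $i$ letters of $\Lambda$ is at most the number among the first $i$ letters of $\Lambda'$. $\Lambda\le_C\Lambda'$ means $\mathrm{cl}(\Lambda)=\mathrm{cl}(\Lambda')$ and $\Lambda\le_S\Lambda'$; $\mathcal M_n^C=({\bf M}_n,\le_C)$. For a poset $P$, $\operatorname{Int}(P)$ is the set of ordered pairs $(x,y)$ of elements with $x\le y$. The map. Let $\pi\in\operatorname{Av}_n(312)$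 with $\mathrm{VHC}(\pi)\neq\emptyset$ (then $\pi_n=n$), and $\mathcal H\in\mathrm{VHC}(\pi)$. A left-to-right maximum of the plot is a point higher than every point to its left. Let $\mathfrak R_0,\dots,\mathfrak R_\ell$ be the left-to-right maxima listed from right to left (so $\mathfrak R_0=(n,n)$, $\mathfrak R_\ell=(1,\pi_1)$), and set $\mathfrak R_{\ell+1}=(0,0)$. For $i\in\{1,\dots,\ell\}$ let $\gamma_i$ be the number of points of the plot whose $x$-coordinate lies strictly between the $x$-coordinates of $\mathfrak R_i$ and $\mathfrak R_{i-1}$, and let $\gamma_i'$ be the number of points of the plot whose height lies strictly between the heights of $\mathfrak R_{i+1}$ and $\mathfrak R_i$. Let $X_j=U$ if $\mathfrak R_{j-1}$ is the northeast endpoint of a hook of $\mathcal H$ and $X_j=E$ otherwise ($1\le j\le\ell$). Then $\widehat{\Lambda\!\Lambda}_n(\mathcal H)=(\Lambda,\Lambda')$ where $\Lambda=X_1D^{\gamma_1}\cdots X_\ell D^{\gamma_\ell}$ and $\Lambda'=X_1D^{\gamma_1'}\cdots X_\ell D^{\gamma_\ell'}$.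
   Formalization: The order Λ ≤_S Λ' is taken to compare prefix heights (number of U's minus number of D's) instead of numbers of U's; read literally, UDE and UED would lie below each other, so M_3^C is not a poset and the count for n=4 is 6 instead of 5. *)

theory Defs
  imports Complex_Main "HOL-Combinatorics.Multiset_Permutations"
begin

section \<open>Permutations and patterns\<close>

text \<open>Permutations are words, i.e. elements of \<open>permutations_of_set {1..n}\<close>; positions
  are counted from 1.\<close>

definition entry :: "nat list \<Rightarrow> nat \<Rightarrow> nat" where
  "entry p i = p ! (i - 1)"

definition contains_pattern :: "nat list \<Rightarrow> nat list \<Rightarrow> bool" where
  "contains_pattern p t \<longleftrightarrow>
     (\<exists>f. strict_mono_on {1..length t} f \<and> f ` {1..length t} \<subseteq> {1..length p} \<and>
          (\<forall>a\<in>{1..length t}. \<forall>b\<in>{1..length t}.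
             entry p (f a) < entry p (f b) \<longleftrightarrow> entry t a < entry t b))"

definition Av :: "nat \<Rightarrow> nat list set \<Rightarrow> nat list set" where
  "Av n T = {p \<in> permutations_of_set {1..n}. \<forall>t\<in>T. \<not> contains_pattern p t}"


section \<open>Valid hook configurations\<close>

definition plot_point :: "nat list \<Rightarrow> nat \<Rightarrow> real \<times> real" where
  "plot_point p i = (real i, real (entry p i))"

definition plot :: "nat list \<Rightarrow> (real \<times> real) set" where
  "plot p = plot_point p ` {1..length p}"

definition descents :: "nat list \<Rightarrow> nat list" where
  "descents p = filter (\<lambda>i. entry p i > entry p (i + 1)) [1..<length p]"

text \<open>A hook is encoded by the pair of positions of its endpoints.\<close>

type_synonym hook = "nat \<times> nat"

definition is_hook :: "nat list \<Rightarrow> hook \<Rightarrow> bool" where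
  "is_hook p H \<longleftrightarrow>
     1 \<le> fst H \<and> fst H < snd H \<and> snd H \<le> length p \<and> entry p (fst H) < entry p (snd H)"

definition southwest :: "nat list \<Rightarrow> hook \<Rightarrow> real \<times> real" where
  "southwest p H = plot_point p (fst H)"

definition northeast :: "nat list \<Rightarrow> hook \<Rightarrow> real \<times> real" where
  "northeast p H = plot_point p (snd H)"

definition hook_drawing :: "nat list \<Rightarrow> hook \<Rightarrow> (real \<times> real) set" where
  "hook_drawing p H =
     {fst (southwest p H)} \<times> {snd (southwest p H)..snd (northeast p H)} \<union>
     {fst (southwest p H)..fst (northeast p H)} \<times> {snd (northeast p H)}"

definition is_vhc :: "nat list \<Rightarrow> hook list \<Rightarrow> bool" where
  "is_vhc p Hs \<longleftrightarrow>
     length Hs = length (descents p) \<and>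
     (\<forall>H\<in>set Hs. is_hook p H) \<and>
     (\<forall>i<length Hs. southwest p (Hs ! i) = plot_point p (descents p ! i)) \<and>
     (\<forall>H\<in>set Hs. \<forall>P\<in>plot p. \<not> (\<exists>Q\<in>hook_drawing p H. fst Q = fst P \<and> snd Q < snd P)) \<and>
     (\<forall>i<length Hs. \<forall>j<length Hs. i \<noteq> j \<longrightarrow>
        (\<forall>P\<in>hook_drawing p (Hs ! i) \<inter> hook_drawing p (Hs ! j).
           P = northeast p (Hs ! i) \<and> P = southwest p (Hs ! j) \<or>
           P = northeast p (Hs ! j) \<and> P = southwest p (Hs ! i)))"

text \<open>A valid hook configuration carries its underlying permutation as first component.\<close>

definition VHC_perm :: "nat list \<Rightarrow> (nat list \<times> hook list) set" where
  "VHC_perm p = {(p, Hs) | Hs. is_vhc p Hs}"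

definition VHC :: "nat list set \<Rightarrow> (nat list \<times> hook list) set" where
  "VHC A = (\<Union>p\<in>A. VHC_perm p)"


section \<open>Motzkin paths\<close>

datatype step = U | D | E

definition motzkin :: "nat \<Rightarrow> step list set" where
  "motzkin n = {w. length w = n \<and> count_list w U = count_list w D \<and>
                   (\<forall>i\<le>n. count_list (take i w) D \<le> count_list (take i w) U)}"

text \<open>The word \<open>X\<^sub>1 D\<^bsup>g\<^sub>1\<^esup> \<dots> X\<^sub>m D\<^bsup>g\<^sub>m\<^esup>\<close>.\<close>

definition path_word :: "step list \<Rightarrow> nat list \<Rightarrow> step list" where
  "path_word Xs gs = concat (map2 (\<lambda>X g. X # replicate g D) Xs gs)"

definition decomposition :: "step list \<Rightarrow> step list \<Rightarrow> nat list \<Rightarrow> bool" where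
  "decomposition w Xs gs \<longleftrightarrow>
     length Xs = length gs \<and> set Xs \<subseteq> {U, E} \<and> w = path_word Xs gs"

lemma path_word_Nil [simp]: "path_word [] gs = []"
  by (simp add: path_word_def)

lemma path_word_Cons [simp]:
  "path_word (X # Xs) (g # gs) = X # replicate g D @ path_word Xs gs"
  by (simp add: path_word_def)

lemma replicate_D_append_eq:
  assumes "replicate g D @ u = replicate h D @ v"
    and "u = [] \<or> hd u \<noteq> D" "v = [] \<or> hd v \<noteq> D"
  shows "g = h \<and> u = v"
  using assms
proof (induction g arbitrary: h)
  case 0
  then show ?case by (cases h) auto
next
  case (Suc g)
  show ?case
  proof (cases h)
    case 0
    with Suc.prems show ?thesis by auto
  next
    case (Suc k)
    with Suc.prems Suc.IH[of k] show ?thesis by simp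
  qed
qed

lemma path_word_start:
  assumes "length Xs = length gs" "set Xs \<subseteq> {U, E}"
  shows "path_word Xs gs = [] \<or> hd (path_word Xs gs) \<noteq> D"
  using assms by (cases Xs; cases gs) auto

lemma decomposition_unique:
  assumes "decomposition w Xs gs" "decomposition w Ys hs"
  shows "Xs = Ys \<and> gs = hs"
  using assms
proof (induction Xs arbitrary: w gs Ys hs)
  case Nil
  then show ?case
    by (cases Ys; cases hs) (auto simp: decomposition_def)
next
  case (Cons X Xs)
  obtain g gs' where gs: "gs = g # gs'"
    using Cons.prems(1) by (cases gs) (auto simp: decomposition_def)
  obtain Y Ys' h hs' where ys: "Ys = Y # Ys'" "hs = h # hs'"
    using Cons.prems by (cases Ys; cases hs) (auto simp: decomposition_def gs)
  have eq: "X = Y" "replicate g D @ path_word Xs gs' = replicate h D @ path_word Ys' hs'"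
    using Cons.prems by (auto simp: decomposition_def gs ys)
  have len: "length Xs = length gs'" "length Ys' = length hs'" "set Xs \<subseteq> {U, E}"
    "set Ys' \<subseteq> {U, E}"
    using Cons.prems by (auto simp: decomposition_def gs ys)
  note st = path_word_start[OF len(1) len(3)] path_word_start[OF len(2) len(4)]
  have "g = h" "path_word Xs gs' = path_word Ys' hs'"
    using replicate_D_append_eq[OF eq(2) st] by auto
  with Cons.IH[of "path_word Xs gs'" gs' Ys' hs'] len eq(1) show ?case
    by (simp add: decomposition_def gs ys)
qed

lemma decomposition_ex_aux:
  "\<exists>g Xs gs. w = replicate g D @ path_word Xs gs \<and> length Xs = length gs \<and> set Xs \<subseteq> {U, E}"
proof (induction w)
  case Nil
  show ?case by (intro exI[of _ 0] exI[of _ "[]"]) simp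
next
  case (Cons a w)
  then obtain g Xs gs where IH: "w = replicate g D @ path_word Xs gs" "length Xs = length gs"
    "set Xs \<subseteq> {U, E}" by blast
  show ?case
  proof (cases "a = D")
    case True
    with IH show ?thesis by (intro exI[of _ "Suc g"] exI[of _ Xs] exI[of _ gs]) simp
  next
    case False
    with IH show ?thesis
      by (intro exI[of _ 0] exI[of _ "a # Xs"] exI[of _ "g # gs"]) (cases a; simp)
  qed
qed

lemma motzkin_decomposition:
  assumes "w \<in> motzkin n"
  shows "\<exists>!(Xs, gs). decomposition w Xs gs"
proof -
  obtain g Xs gs where w: "w = replicate g D @ path_word Xs gs" "length Xs = length gs"
    "set Xs \<subseteq> {U, E}"
    using decomposition_ex_aux[of w] by blast
  have "g = 0"
  proof (rule ccontr)
    assume "g \<noteq> 0"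
    then obtain v where wD: "w = D # v" using w(1) by (cases g) auto
    with assms have "1 \<le> n" "\<forall>i\<le>n. count_list (take i w) D \<le> count_list (take i w) U"
      by (auto simp: motzkin_def)
    then have "count_list (take 1 w) D \<le> count_list (take 1 w) U" by blast
    with wD show False by simp
  qed
  with w have "decomposition w Xs gs" by (simp add: decomposition_def)
  then show ?thesis using decomposition_unique by (intro ex1I[of _ "(Xs, gs)"]) auto
qed

text \<open>The class of a path; by the uniqueness above the witnesses are determined.\<close>

definition path_class :: "step list \<Rightarrow> nat set" where
  "path_class w =
     {j. \<exists>Xs gs. decomposition w Xs gs \<and> j \<in> {1..length Xs} \<and> Xs ! (j - 1) = E}"

definition height :: "step list \<Rightarrow> int" where
  "height w = int (count_list w U) - int (count_list w D)"

text \<open>One path lies weakly below another if all its prefix heights, i.e. numbers of up steps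
  minus numbers of down steps, are at most those of the other path. For Dyck paths
  it would suffice to compare the numbers of up steps; for Motzkin paths it would not: the paths
  UDE and UED have the same numbers of up steps in all prefixes and the same class, so that
  antisymmetry would fail.\<close>

definition motzkin_S :: "nat \<Rightarrow> (step list \<times> step list) set" where
  "motzkin_S n = {(w, w'). w \<in> motzkin n \<and> w' \<in> motzkin n \<and>
                           (\<forall>i\<in>{1..n}. height (take i w) \<le> height (take i w'))}"

definition motzkin_C :: "nat \<Rightarrow> (step list \<times> step list) set" where
  "motzkin_C n = {(w, w'). path_class w = path_class w' \<and> (w, w') \<in> motzkin_S n}"

lemma motzkin_S_antisym:
  assumes "(w, w') \<in> motzkin_S n" "(w', w) \<in> motzkin_S n"
  shows "w = w'"
proof (rule nth_equalityI)
  have len: "length w = n" "length w' = n"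
    using assms by (auto simp: motzkin_S_def motzkin_def)
  then show "length w = length w'" by simp
  have h: "height (take i w) = height (take i w')" if "i \<le> n" for i
    using assms that by (cases "i = 0") (auto simp: motzkin_S_def intro!: antisym)
  fix i assume i: "i < length w"
  have "height (take (Suc i) w) = height (take i w) + height [w ! i]"
    "height (take (Suc i) w') = height (take i w') + height [w' ! i]"
    using i len by (auto simp: take_Suc_conv_app_nth height_def)
  then have "height [w ! i] = height [w' ! i]"
    using h[of i] h[of "Suc i"] i len by auto
  then show "w ! i = w' ! i"
    by (cases "w ! i"; cases "w' ! i") (auto simp: height_def)
qed

lemma motzkin_C_partial_order: "partial_order_on (motzkin n) (motzkin_C n)"
proof -
  have "motzkin_C n \<subseteq> motzkin n \<times> motzkin n" "\<forall>w\<in>motzkin n. (w, w) \<in> motzkin_C n"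
    by (auto simp: motzkin_C_def motzkin_S_def)
  moreover have "trans (motzkin_C n)"
    unfolding trans_def motzkin_C_def motzkin_S_def by (auto intro: order_trans)
  moreover have "antisym (motzkin_C n)"
    unfolding antisym_def motzkin_C_def using motzkin_S_antisym by blast
  ultimately show ?thesis
    by (auto simp: partial_order_on_def preorder_on_def refl_on_def)
qed

text \<open>The intervals of the poset with carrier \<open>A\<close> and order relation \<open>r\<close>.\<close>

definition intervals :: "'a set \<Rightarrow> ('a \<times> 'a) set \<Rightarrow> ('a \<times> 'a) set" where
  "intervals A r = {(x, y). x \<in> A \<and> y \<in> A \<and> (x, y) \<in> r}"


section \<open>The map\<close>

definition is_lr_max :: "nat list \<Rightarrow> nat \<Rightarrow> bool" where
  "is_lr_max p i \<longleftrightarrow> (\<forall>k\<in>{1..<i}. entry p k < entry p i)"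

text \<open>The left-to-right maxima from right to left.\<close>

definition lr_maxima :: "nat list \<Rightarrow> (real \<times> real) list" where
  "lr_maxima p = map (plot_point p) (rev (filter (is_lr_max p) [1..<length p + 1]))"

text \<open>The largest index \<open>\<ell>\<close>; the maxima are numbered from 0, so it is one less than their
  number.\<close>

definition ell :: "nat list \<Rightarrow> nat" where
  "ell p = length (lr_maxima p) - 1"

definition R :: "nat list \<Rightarrow> nat \<Rightarrow> real \<times> real" where
  "R p i = (lr_maxima p @ [(0, 0)]) ! i"

definition gam :: "nat list \<Rightarrow> nat \<Rightarrow> nat" where
  "gam p i = card {P \<in> plot p. fst (R p i) < fst P \<and> fst P < fst (R p (i - 1))}"

definition gam' :: "nat list \<Rightarrow> nat \<Rightarrow> nat" where
  "gam' p i = card {P \<in> plot p. snd (R p (i + 1)) < snd P \<and> snd P < snd (R p i)}"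

definition X_letter :: "nat list \<Rightarrow> hook list \<Rightarrow> nat \<Rightarrow> step" where
  "X_letter p Hs j = (if \<exists>H\<in>set Hs. R p (j - 1) = northeast p H then U else E)"

definition LL :: "nat list \<times> hook list \<Rightarrow> step list \<times> step list" where
  "LL = (\<lambda>(p, Hs). let js = [1..<ell p + 1]; Xs = map (X_letter p Hs) js in
           (path_word Xs (map (gam p) js), path_word Xs (map (gam' p) js)))"

end

theory Submission
  imports Defs
begin

text \<open>Let \<open>A\<close> and \<open>V\<close> be the sets of positions and values of the left-to-right maxima of a
  312-avoiding permutation. Greedy reconstruction from left to right shows that \<open>(A, V)\<close> determines
  the permutation, and that \<open>(A, V)\<close> occurs iff
  \<open>|V \<inter> [1, k - 1]| < |A \<inter> [1, k]|\<close> for all \<open>k\<close>; for the two words of the map this is exactly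
  the condition that the first lies below the second. The descents are the \<open>d\<close> with
  \<open>d + 1 \<notin> A\<close>, and a valid hook configuration is the same as a noncrossing injection
  \<open>f\<close> from descents to \<open>A\<close> with \<open>d < f d\<close>. Like a matching of parentheses it is determined by its
  image, and a set is such an image iff the ballot condition holds, that is, iff the first word is a
  Motzkin path.\<close>

subsection \<open>Permutations avoiding 312\<close>

text \<open>The problem splits because \<open>A\<close> is shared by two otherwise separate choices.
  Every northeast endpoint is a record (left-to-right maximum), and records are ordered alike by
  position and by height, so the hook conditions can be expressed in positions. The first word thus
  encodes \<open>A\<close> together with the set \<open>S\<close> of northeast endpoints, while the
  letters \<open>D\<close> of the second encode \<open>V\<close>; sharing the letters
  \<open>U\<close> and \<open>E\<close> corresponds to \<open>|A| = |V|\<close>. The shift in the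
  dominance inequality comes from what the words omit: position 1 is always a record position and
  height \<open>n\<close> always a record value, and neither gets a letter. The first word therefore
  covers positions \<open>n\<close> to 2, the second heights \<open>n - 1\<close> to 1. That
  position \<open>n\<close> is a record is forced by the hooks: a descent at \<open>n - 1\<close>
  would leave its hook no record to end at. Once two words have the same sequence of
  \<open>U\<close>s and \<open>E\<close>s, comparing prefix heights amounts to comparing numbers of
  letters other than \<open>D\<close>, and a word above a Motzkin word is then itself
  Motzkin.\<close>

definition lr_positions :: "nat list \<Rightarrow> nat set" where
  "lr_positions p = {i \<in> {1..length p}. is_lr_max p i}"

definition lr_values :: "nat list \<Rightarrow> nat set" where
  "lr_values p = entry p ` lr_positions p"

definition avoids_312 :: "nat list \<Rightarrow> bool" where
  "avoids_312 p \<longleftrightarrow> (\<forall>i j k. 1 \<le> i \<and> i < j \<and> j < k \<and> k \<le> length p \<longrightarrow>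
     \<not> (entry p j < entry p k \<and> entry p k < entry p i))"

lemma contains_312_iff: "contains_pattern p [3, 1, 2] \<longleftrightarrow> \<not> avoids_312 p"
proof
  assume "contains_pattern p [3, 1, 2]"
  then obtain f where f: "strict_mono_on {1..3} f" "f ` {1..3} \<subseteq> {1..length p}"
    "\<And>a b. a \<in> {1..3} \<Longrightarrow> b \<in> {1..3} \<Longrightarrow>
       entry p (f a) < entry p (f b) \<longleftrightarrow> entry [3, 1, 2] a < entry [3, 1, 2] b"
    unfolding contains_pattern_def by (auto simp: numeral_3_eq_3)
  have "f 1 < f 2" "f 2 < f 3"
    using f(1) by (auto intro: strict_mono_onD)
  moreover have "1 \<le> f 1" "f 3 \<le> length p"
    using f(2) by (simp_all add: image_subset_iff)
  moreover have "entry p (f 2) < entry p (f 3)" "entry p (f 3) < entry p (f 1)"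
    using f(3)[of 2 3] f(3)[of 3 1] by (auto simp: entry_def)
  ultimately show "\<not> avoids_312 p"
    unfolding avoids_312_def by blast
next
  assume "\<not> avoids_312 p"
  then obtain i j k where ijk: "1 \<le> i" "i < j" "j < k" "k \<le> length p"
    "entry p j < entry p k" "entry p k < entry p i"
    unfolding avoids_312_def by blast
  define f where "f x = (if x = 1 then i else if x = 2 then j else k)" for x :: nat
  have set3: "{1..length [3::nat, 1, 2]} = {1, 2, 3}" by auto
  have "strict_mono_on {1, 2, 3} f"
    using ijk by (auto simp: strict_mono_on_def f_def)
  moreover have "f ` {1, 2, 3} \<subseteq> {1..length p}"
    using ijk by (auto simp: f_def)
  moreover have "\<forall>a\<in>{1, 2, 3}. \<forall>b\<in>{1, 2, 3}.
      entry p (f a) < entry p (f b) \<longleftrightarrow> entry [3, 1, 2] a < entry [3, 1, 2] b"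
    using ijk by (auto simp: f_def entry_def)
  ultimately show "contains_pattern p [3, 1, 2]"
    unfolding contains_pattern_def set3 by blast
qed

lemma Av_312_iff:
  "p \<in> Av n {[3, 1, 2]} \<longleftrightarrow> p \<in> permutations_of_set {1..n} \<and> avoids_312 p"
  using contains_312_iff[of p] by (simp add: Av_def)

lemma permutation_length: "p \<in> permutations_of_set {1..n} \<Longrightarrow> length p = n"
  using length_finite_permutations_of_set by force

lemma entry_image_prefix: "k \<le> length p \<Longrightarrow> entry p ` {1..k} = set (take k p)"
proof -
  assume k: "k \<le> length p"
  have "{1..k} = Suc ` {..<k}"
    by (auto simp: image_iff intro: Suc_pred[symmetric])
       (metis Suc_le_D Suc_le_eq lessThan_iff)
  then have "entry p ` {1..k} = (!) p ` {..<k}"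
    by (simp add: image_image entry_def)
  also have "\<dots> = set (take k p)"
    using k nth_image[of k p] by (simp add: atLeast0LessThan)
  finally show ?thesis .
qed

lemma entry_inj_on: "distinct p \<Longrightarrow> inj_on (entry p) {1..length p}"
  by (auto simp: inj_on_def entry_def nth_eq_iff_index_eq)

lemma permutation_entry_bij:
  assumes "p \<in> permutations_of_set {1..n}"
  shows "bij_betw (entry p) {1..n} {1..n}"
  using entry_inj_on[of p] entry_image_prefix[of n p] permutation_length[OF assms]
    permutations_of_setD[OF assms]
  by (simp add: bij_betw_def)

lemma lr_max_mono:
  assumes "i \<in> lr_positions p" "j \<in> lr_positions p"
  shows "entry p i < entry p j \<longleftrightarrow> i < j"
  using assms unfolding lr_positions_def is_lr_max_def
  by (metis (no_types, lifting) atLeastLessThan_iff atLeastAtMost_iff mem_Collect_eq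
      not_less_iff_gr_or_eq)

lemma lr_values_inj: "inj_on (entry p) (lr_positions p)"
  by (metis inj_onI lr_max_mono nat_neq_iff)

lemma card_lr_values: "card (lr_values p) = card (lr_positions p)"
  by (simp add: lr_values_def card_image lr_values_inj)

lemma finite_lr_positions [simp]: "finite (lr_positions p)" "finite (lr_values p)"
  by (auto simp: lr_positions_def lr_values_def)

lemma one_in_lr_positions: "p \<noteq> [] \<Longrightarrow> 1 \<in> lr_positions p"
  by (cases p) (auto simp: lr_positions_def is_lr_max_def)

lemma dominating_lr_max:
  assumes "1 \<le> i" "i \<le> length p"
  shows "\<exists>a\<in>lr_positions p. a \<le> i \<and> entry p i \<le> entry p a"
  using assms
proof (induction i rule: less_induct)
  case (less i)
  show ?case
  proof (cases "is_lr_max p i")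
    case True
    with less.prems show ?thesis by (auto simp: lr_positions_def)
  next
    case False
    then obtain k where k: "1 \<le> k" "k < i" "entry p i \<le> entry p k"
      by (auto simp: is_lr_max_def not_less)
    with less.IH[of k] less.prems obtain a where
      "a \<in> lr_positions p" "a \<le> k" "entry p k \<le> entry p a" by auto
    with k show ?thesis by (intro bexI[of _ a]) auto
  qed
qed

text \<open>If \<open>d + 1\<close> is not a record, a larger entry precedes it at some
  \<open>k \<le> d\<close>. For \<open>k < d\<close>, an ascent at \<open>d\<close> would make
  \<open>k\<close>, \<open>d\<close>, \<open>d + 1\<close> a 312. Hence the record positions alone
  determine the descents.\<close>

lemma descent_iff:
  assumes "avoids_312 p" "distinct p"
  shows "d \<in> set (descents p) \<longleftrightarrow> 1 \<le> d \<and> d < length p \<and> d + 1 \<notin> lr_positions p"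
proof -
  have "entry p d > entry p (d + 1) \<longleftrightarrow> d + 1 \<notin> lr_positions p" if d: "1 \<le> d" "d < length p"
  proof
    assume "entry p d > entry p (d + 1)"
    with d show "d + 1 \<notin> lr_positions p"
      by (auto simp: lr_positions_def is_lr_max_def not_less intro!: bexI[of _ d])
  next
    assume "d + 1 \<notin> lr_positions p"
    then obtain k where k: "1 \<le> k" "k \<le> d" "entry p (d + 1) \<le> entry p k"
      using d by (auto simp: lr_positions_def is_lr_max_def not_less)
    have ne: "entry p k \<noteq> entry p (d + 1)"
      using inj_onD[OF entry_inj_on[OF assms(2)], of k "d + 1"] d k by auto
    show "entry p d > entry p (d + 1)"
    proof (cases "k = d")
      case False
      then have "\<not> (entry p d < entry p (d + 1) \<and> entry p (d + 1) < entry p k)"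
        using assms(1) d k unfolding avoids_312_def by (metis Suc_eq_plus1 Suc_leI lessI nat_less_le)
      moreover have "entry p d \<noteq> entry p (d + 1)"
        using inj_onD[OF entry_inj_on[OF assms(2)], of d "d + 1"] d by auto
      ultimately show ?thesis using k ne by linarith
    qed (use k ne in auto)
  qed
  then show ?thesis by (auto simp: descents_def)
qed

text \<open>By pigeonhole one of the first \<open>k\<close> entries is at least \<open>k\<close>,
  hence so is the record \<open>a\<close> dominating it. Records with value below \<open>k\<close>
  lie strictly left of \<open>a\<close>, and \<open>a\<close> itself makes the inequality
  strict.\<close>

lemma lr_dominance:
  assumes p: "p \<in> permutations_of_set {1..n}" and k: "k \<in> {1..n}"
  shows "card (lr_values p \<inter> {..<k}) < card (lr_positions p \<inter> {..k})"
proof -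
  note len = permutation_length[OF p]
  have "\<exists>i\<in>{1..k}. k \<le> entry p i"
  proof (rule ccontr)
    assume "\<not> ?thesis"
    then have "entry p ` {1..k} \<subseteq> {1..<k}"
      using bij_betwE[OF permutation_entry_bij[OF p]] k by force
    then have "card (entry p ` {1..k}) \<le> card {1..<k}"
      by (intro card_mono) auto
    moreover have "inj_on (entry p) {1..k}"
      using permutation_entry_bij[OF p] k by (auto simp: bij_betw_def intro: inj_on_subset)
    ultimately show False using k by (auto simp: card_image)
  qed
  then obtain i where "i \<in> {1..k}" "k \<le> entry p i" by blast
  then obtain a where a: "a \<in> lr_positions p" "a \<le> k" "k \<le> entry p a"
    using dominating_lr_max[of i p] k len by force
  let ?B = "{i \<in> lr_positions p. entry p i < k}"
  have "lr_values p \<inter> {..<k} = entry p ` ?B"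
    by (auto simp: lr_values_def)
  then have "card (lr_values p \<inter> {..<k}) \<le> card ?B"
    by (simp add: card_image_le)
  also have "\<dots> < card (lr_positions p \<inter> {..k})"
  proof (rule psubset_card_mono)
    have "i < a" if "i \<in> ?B" for i
      using that a lr_max_mono[of i p a] by auto
    then show "?B \<subset> lr_positions p \<inter> {..k}"
      using a by fastforce
  qed simp
  finally show ?thesis .
qed

text \<open>In a 312-avoiding permutation with record positions \<open>A\<close> and record values \<open>V\<close>, the
  \<open>k\<close>-th entry is forced by the set \<open>W\<close> of earlier ones: a non-record must be the largest unused
  value below the current maximum, since a larger unused one would complete a 312 later on.\<close>

definition next_entry :: "nat set \<Rightarrow> nat set \<Rightarrow> nat \<Rightarrow> nat set \<Rightarrow> nat" where
  "next_entry A V k W = (if k \<in> A then Min (V - W) else Max ({1..<Max W} - W))"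

primrec build :: "nat set \<Rightarrow> nat set \<Rightarrow> nat \<Rightarrow> nat list" where
  "build A V 0 = []"
| "build A V (Suc k) = build A V k @ [next_entry A V (Suc k) (set (build A V k))]"

lemma permutation_eq_build:
  assumes p: "p \<in> permutations_of_set {1..n}" and av: "avoids_312 p" and "k \<le> n"
  shows "take k p = build (lr_positions p) (lr_values p) k"
  using \<open>k \<le> n\<close>
proof (induction k)
  case (Suc k)
  note len = permutation_length[OF p]
  note bij = permutation_entry_bij[OF p]
  let ?W = "set (take k p)"
  have W: "?W = entry p ` {1..k}"
    using entry_image_prefix[of k p] len Suc.prems by simp
  have in_W: "entry p i \<in> ?W \<longleftrightarrow> i \<le> k" if "i \<in> {1..n}" for i
    unfolding W using that Suc.prems bij_betw_imp_inj_on[OF bij] 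
    by (subst inj_on_image_mem_iff[of _ "{1..n}"]) auto
  have "entry p (Suc k) = next_entry (lr_positions p) (lr_values p) (Suc k) ?W"
  proof (cases "Suc k \<in> lr_positions p")
    case True
    have "Min (lr_values p - ?W) = entry p (Suc k)"
    proof (rule Min_eqI)
      show "entry p (Suc k) \<in> lr_values p - ?W"
        using True in_W[of "Suc k"] Suc.prems by (auto simp: lr_values_def)
      fix y assume "y \<in> lr_values p - ?W"
      then obtain i where i: "i \<in> lr_positions p" "y = entry p i" "y \<notin> ?W"
        by (auto simp: lr_values_def)
      then have "Suc k \<le> i"
        using in_W[of i] len by (auto simp: lr_positions_def)
      with i True lr_max_mono[of "Suc k" p i] show "entry p (Suc k) \<le> y"
        by (cases "i = Suc k") auto
    qed simp
    with True show ?thesis by (simp add: next_entry_def)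
  next
    case False
    have ne: "?W \<noteq> {}"
      using False one_in_lr_positions[of p] Suc.prems len by (cases k; cases "p = []") auto
    have "Max ({1..<Max ?W} - ?W) = entry p (Suc k)"
    proof (rule Max_eqI)
      obtain a where a: "a \<in> {1..k}" "entry p (Suc k) < entry p a"
        using False Suc.prems len inj_onD[OF bij_betw_imp_inj_on[OF bij], of _ "Suc k"]
        by (force simp: lr_positions_def is_lr_max_def not_less nat_less_le)
      then have "entry p a \<le> Max ?W"
        using W by (intro Max_ge) auto
      with a have "entry p (Suc k) < Max ?W" by simp
      moreover have "1 \<le> entry p (Suc k)"
        using bij_betwE[OF bij] Suc.prems by force
      ultimately show "entry p (Suc k) \<in> {1..<Max ?W} - ?W"
        using in_W[of "Suc k"] Suc.prems by auto
      fix y assume y: "y \<in> {1..<Max ?W} - ?W"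
      obtain m where m: "m \<in> {1..k}" "Max ?W = entry p m"
        using Max_in[OF _ ne] W by auto
      have "entry p m \<in> {1..n}"
        using bij_betwE[OF bij] m Suc.prems by auto
      then have "y \<in> entry p ` {1..n}"
        using y m bij_betw_imp_surj_on[OF bij] by auto
      then obtain i where i: "i \<in> {1..n}" "y = entry p i" by blast
      have "k < i" using in_W[OF i(1)] y i by auto
      show "y \<le> entry p (Suc k)"
      proof (cases "i = Suc k")
        case False
        then have "\<not> (entry p (Suc k) < entry p i \<and> entry p i < entry p m)"
          using av m \<open>k < i\<close> i len unfolding avoids_312_def
          by (metis Suc_lessI atLeastAtMost_iff le_imp_less_Suc)
        then show ?thesis using y m i by auto
      qed (use i in simp)
    qed simp
    with False show ?thesis by (simp add: next_entry_def)
  qed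
  moreover have "take (Suc k) p = take k p @ [entry p (Suc k)]"
    using Suc.prems len by (simp add: take_Suc_conv_app_nth entry_def)
  ultimately show ?case using Suc by simp
qed simp

lemma permutation_determined:
  assumes "p \<in> permutations_of_set {1..n}" "avoids_312 p"
    and "q \<in> permutations_of_set {1..n}" "avoids_312 q"
    and "lr_positions p = lr_positions q" "lr_values p = lr_values q"
  shows "p = q"
  using permutation_eq_build[of p n n] permutation_eq_build[of q n n] assms
  by (simp add: permutation_length)

section \<open>Realizing prescribed record positions and values\<close>

lemma entry_append_left: "1 \<le> i \<Longrightarrow> i \<le> length p \<Longrightarrow> entry (p @ q) i = entry p i"
  by (auto simp: entry_def nth_append)

lemma entry_snoc: "entry (p @ [x]) (Suc (length p)) = x"
  by (simp add: entry_def)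

lemma is_lr_max_append_left: "1 \<le> i \<Longrightarrow> i \<le> length p \<Longrightarrow> is_lr_max (p @ [x]) i = is_lr_max p i"
  by (simp add: is_lr_max_def entry_append_left)

lemma is_lr_max_snoc: "is_lr_max (p @ [x]) (Suc (length p)) \<longleftrightarrow> (\<forall>y\<in>set p. y < x)"
proof -
  have "set p = entry p ` {1..<Suc (length p)}"
    using entry_image_prefix[of "length p" p] by (simp add: atLeastLessThanSuc_atLeastAtMost)
  then show ?thesis
    by (simp add: is_lr_max_def entry_append_left entry_snoc)
qed

lemma is_lr_max_first: "is_lr_max p (Suc 0)"
  by (simp add: is_lr_max_def)

text \<open>Unlike 312-avoidance, this also controls the values that are still to be placed, which makes it
  an invariant of the greedy construction.\<close>

definition no_gap :: "nat list \<Rightarrow> bool" where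
  "no_gap p \<longleftrightarrow> (\<forall>i j y. 1 \<le> i \<and> i < j \<and> j \<le> length p \<and> y \<notin> set (take j p) \<longrightarrow>
     \<not> (entry p j < y \<and> y < entry p i))"

lemma no_gap_avoids_312:
  assumes "no_gap p" "distinct p"
  shows "avoids_312 p"
  unfolding avoids_312_def
proof (intro allI impI)
  fix i j k assume ijk: "1 \<le> i \<and> i < j \<and> j < k \<and> k \<le> length p"
  have "entry p k \<notin> entry p ` {1..j}"
    using inj_on_image_mem_iff[OF entry_inj_on[OF assms(2)], of k "{1..j}"] ijk by auto
  then have "entry p k \<notin> set (take j p)"
    using entry_image_prefix[of j p] ijk by simp
  then show "\<not> (entry p j < entry p k \<and> entry p k < entry p i)"
    using assms(1) ijk unfolding no_gap_def by (meson less_imp_le_nat order_trans)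
qed

lemma no_gap_snoc:
  assumes "no_gap p" "\<And>y z. z \<in> set p \<Longrightarrow> x < y \<Longrightarrow> y < z \<Longrightarrow> y \<in> set p"
  shows "no_gap (p @ [x])"
  unfolding no_gap_def
proof (intro allI impI)
  fix i j y assume *: "1 \<le> i \<and> i < j \<and> j \<le> length (p @ [x]) \<and> y \<notin> set (take j (p @ [x]))"
  show "\<not> (entry (p @ [x]) j < y \<and> y < entry (p @ [x]) i)"
  proof (cases "j = Suc (length p)")
    case True
    have "entry p i \<in> set p"
      using * True by (auto simp: entry_def)
    with assms(2)[of "entry p i" y] * True show ?thesis
      by (auto simp: entry_snoc entry_append_left)
  next
    case False
    with * have j: "1 \<le> i" "i < j" "j \<le> length p" "y \<notin> set (take j p)" by auto
    with assms(1) have "\<not> (entry p j < y \<and> y < entry p i)"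
      unfolding no_gap_def by blast
    with j show ?thesis by (simp add: entry_append_left)
  qed
qed

definition partial_perm :: "nat set \<Rightarrow> nat set \<Rightarrow> nat \<Rightarrow> nat list \<Rightarrow> bool" where
  "partial_perm A V n p \<longleftrightarrow> distinct p \<and> set p \<subseteq> {1..n} \<and> no_gap p \<and>
     card (V \<inter> set p) = card (A \<inter> {1..length p}) \<and>
     (\<forall>v\<in>V \<inter> set p. \<forall>v'\<in>V. v' < v \<longrightarrow> v' \<in> set p) \<and>
     (p \<noteq> [] \<longrightarrow> Max (set p) \<in> V) \<and>
     (\<forall>i\<in>{1..length p}. is_lr_max p i \<longleftrightarrow> i \<in> A) \<and>
     (\<forall>i\<in>{1..length p}. entry p i \<in> V \<longleftrightarrow> i \<in> A)"

lemma partial_perm_snoc_record: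
  assumes p: "partial_perm A V n p" and V: "V \<subseteq> {1..n}" "finite A" "card A = card V"
    and k: "Suc (length p) \<in> A"
  shows "partial_perm A V n (p @ [Min (V - set p)])"
proof -
  have finV: "finite V" using V finite_subset by blast
  have "Suc (length p) \<notin> A \<inter> {1..length p}" by simp
  then have "A \<inter> {1..length p} \<subset> A" using k by blast
  then have "card (V \<inter> set p) < card A"
    using p V(2) unfolding partial_perm_def by (simp add: psubset_card_mono)
  then have ne: "V - set p \<noteq> {}"
    using V(3) by (metis Diff_eq_empty_iff inf.absorb1 less_irrefl)
  define x where "x = Min (V - set p)"
  have x: "x \<in> V" "x \<notin> set p"
    using Min_in[of "V - set p"] ne finV by (auto simp: x_def)
  have x_min: "x \<le> v" if "v \<in> V" "v \<notin> set p" for v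
    using that finV by (auto simp: x_def)
  have big: "y < x" if "y \<in> set p" for y
  proof -
    have "p \<noteq> []" using that by auto
    then have M: "Max (set p) \<in> V \<inter> set p"
      using p by (auto simp: partial_perm_def)
    then have "Max (set p) < x"
      using p x unfolding partial_perm_def by (metis IntE linorder_neqE_nat)
    then show ?thesis using that by (meson List.finite_set Max_ge le_less_trans)
  qed
  have "A \<inter> {1..Suc (length p)} = insert (Suc (length p)) (A \<inter> {1..length p})"
    using k by auto
  moreover have "V \<inter> set (p @ [x]) = insert x (V \<inter> set p)"
    using x by auto
  ultimately have card: "card (V \<inter> set (p @ [x])) = card (A \<inter> {1..length (p @ [x])})"
    using p x by (simp add: partial_perm_def)
  have "no_gap (p @ [x])"
    using p big by (intro no_gap_snoc) (auto simp: partial_perm_def dest: less_asym less_trans)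
  moreover have "Max (set (p @ [x])) = x"
    using big by (intro Max_eqI) (auto dest: less_imp_le)
  moreover have "\<forall>v\<in>V \<inter> set (p @ [x]). \<forall>v'\<in>V. v' < v \<longrightarrow> v' \<in> set (p @ [x])"
  proof (intro ballI impI)
    fix v v' assume v: "v \<in> V \<inter> set (p @ [x])" "v' \<in> V" "v' < v"
    show "v' \<in> set (p @ [x])"
    proof (cases "v = x")
      case True
      with v x_min[of v'] show ?thesis by auto
    next
      case False
      with v p show ?thesis by (auto simp: partial_perm_def)
    qed
  qed
  moreover have "\<forall>i\<in>{1..length (p @ [x])}. is_lr_max (p @ [x]) i \<longleftrightarrow> i \<in> A"
    using p big k
    by (auto simp: partial_perm_def le_Suc_eq is_lr_max_append_left is_lr_max_snoc
        is_lr_max_first)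
  moreover have "\<forall>i\<in>{1..length (p @ [x])}. entry (p @ [x]) i \<in> V \<longleftrightarrow> i \<in> A"
    using p x k entry_snoc[of "[]" x]
    by (auto simp: partial_perm_def le_Suc_eq entry_append_left entry_snoc)
  moreover have "distinct (p @ [x])" "set (p @ [x]) \<subseteq> {1..n}"
    using p x V by (auto simp: partial_perm_def)
  ultimately have "partial_perm A V n (p @ [x])"
    unfolding partial_perm_def using x card by (intro conjI impI) (assumption | simp)+
  then show ?thesis by (simp add: x_def)
qed

lemma partial_perm_snoc_fill:
  assumes p: "partial_perm A V n p" and V: "V \<subseteq> {1..n}"
    and k: "Suc (length p) \<notin> A" "p \<noteq> []"
    and dom: "card (V \<inter> {..<Suc (length p)}) < card (A \<inter> {..Suc (length p)})" "0 \<notin> A"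
  shows "partial_perm A V n (p @ [Max ({1..<Max (set p)} - set p)])"
proof -
  let ?M = "Max (set p)"
  have M: "?M \<in> V" "?M \<in> set p"
    using p k by (auto simp: partial_perm_def)
  have AI: "A \<inter> {..Suc (length p)} = A \<inter> {1..length p}"
    using k dom(2) by (auto simp: le_Suc_eq) (metis Suc_leI not_gr_zero)
  \<comment> \<open>Otherwise all used elements of \<open>V\<close>, as many as \<open>A\<close> has
    in the prefix, would be at most \<open>length p\<close>, against dominance at
    \<open>Suc (length p)\<close>. With \<open>length p < ?M\<close>, the entries placed so far are
    too few to exhaust \<open>{1..?M}\<close>.\<close>
  have "length p < ?M"
  proof (rule ccontr)
    assume "\<not> ?thesis"
    then have "V \<inter> set p \<subseteq> V \<inter> {..<Suc (length p)}"
      by (auto simp: less_Suc_eq_le not_less intro: order_trans[OF Max_ge])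
    then have "card (V \<inter> set p) \<le> card (V \<inter> {..<Suc (length p)})"
      by (intro card_mono) auto
    with dom(1) p AI show False by (simp add: partial_perm_def)
  qed
  then have "\<not> {1..?M} \<subseteq> set p"
    using p card_mono[of "set p" "{1..?M}"] by (auto simp: partial_perm_def distinct_card)
  then obtain z where z: "z \<in> {1..?M}" "z \<notin> set p" by blast
  then have "z \<noteq> ?M" using M by metis
  with z have "z \<in> {1..<?M} - set p" by (simp add: nat_less_le)
  then have ne: "{1..<?M} - set p \<noteq> {}" by blast
  define x where "x = Max ({1..<?M} - set p)"
  have x: "x \<in> {1..<?M}" "x \<notin> set p"
    using Max_in[OF _ ne] by (auto simp: x_def)
  have x_max: "y \<le> x" if "y \<in> {1..<?M}" "y \<notin> set p" for y
    using that by (auto simp: x_def)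
  have xV: "x \<notin> V"
    using p M x by (auto simp: partial_perm_def)
  have "no_gap (p @ [x])"
  proof (rule no_gap_snoc)
    fix y z assume "z \<in> set p" "x < y" "y < z"
    moreover have "y < ?M" using less_le_trans[OF \<open>y < z\<close> Max_ge[OF finite_set \<open>z \<in> set p\<close>]] .
    ultimately show "y \<in> set p"
      using x_max[of y] x by (cases "y \<in> set p") auto
  qed (use p in \<open>simp add: partial_perm_def\<close>)
  moreover have VI: "V \<inter> set (p @ [x]) = V \<inter> set p"
    using xV by auto
  moreover have "A \<inter> {1..length (p @ [x])} = A \<inter> {1..length p}"
    using k by (auto simp: le_Suc_eq)
  moreover have "Max (set (p @ [x])) = ?M"
    using x k by (auto simp: max_def)
  moreover have "\<forall>i\<in>{1..length (p @ [x])}. is_lr_max (p @ [x]) i \<longleftrightarrow> i \<in> A"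
  proof
    fix i assume i: "i \<in> {1..length (p @ [x])}"
    have "\<not> is_lr_max (p @ [x]) (Suc (length p))"
      unfolding is_lr_max_snoc using M(2) x(1) by (meson atLeastLessThan_iff less_asym)
    moreover have "is_lr_max (p @ [x]) i \<longleftrightarrow> i \<in> A" if "i \<noteq> Suc (length p)"
      using p i that by (auto simp: partial_perm_def is_lr_max_append_left)
    ultimately show "is_lr_max (p @ [x]) i \<longleftrightarrow> i \<in> A"
      using k(1) by metis
  qed
  moreover have "\<forall>i\<in>{1..length (p @ [x])}. entry (p @ [x]) i \<in> V \<longleftrightarrow> i \<in> A"
    using p xV k by (auto simp: partial_perm_def le_Suc_eq entry_append_left entry_snoc)
  moreover have "x \<le> n" using x M V by auto
  moreover have "distinct (p @ [x])" "set (p @ [x]) \<subseteq> {1..n}"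
    using p x \<open>x \<le> n\<close> by (auto simp: partial_perm_def)
  moreover have "card (V \<inter> set p) = card (A \<inter> {1..length p})"
    using p by (simp add: partial_perm_def)
  moreover have "\<forall>v\<in>V \<inter> set p. \<forall>v'\<in>V. v' < v \<longrightarrow> v' \<in> set (p @ [x])"
    using p by (auto simp: partial_perm_def)
  ultimately have "partial_perm A V n (p @ [x])"
    unfolding partial_perm_def VI using M(1) by (intro conjI impI) (assumption | simp)+
  then show ?thesis by (simp add: x_def)
qed

lemma length_build [simp]: "length (build A V k) = k"
  by (induction k) auto

lemma partial_perm_build:
  assumes V: "V \<subseteq> {1..n}" and A: "A \<subseteq> {1..n}" "1 \<in> A" and card: "card A = card V"
    and dom: "\<And>k. k \<in> {1..n} \<Longrightarrow> card (V \<inter> {..<k}) < card (A \<inter> {..k})"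
    and "k \<le> n"
  shows "partial_perm A V n (build A V k)"
  using \<open>k \<le> n\<close>
proof (induction k)
  case 0
  then show ?case by (simp add: partial_perm_def no_gap_def)
next
  case (Suc k)
  have finA: "finite A" using A finite_subset by blast
  show ?case
  proof (cases "Suc k \<in> A")
    case True
    with partial_perm_snoc_record[of A V n "build A V k"] Suc V finA card show ?thesis
      by (simp add: next_entry_def)
  next
    case False
    \<comment> \<open>The first entry is always placed as a record, so the maximum needed for
      filling exists.\<close>
    then have "k \<noteq> 0" using A by (cases k) auto
    then have "build A V k \<noteq> []" by (metis length_build list.size(3))
    moreover have "0 \<notin> A" using A by auto
    ultimately show ?thesis
      using partial_perm_snoc_fill[of A V n "build A V k"] Suc V dom[of "Suc k"] False
      by (simp add: next_entry_def)
  qed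
qed

lemma exists_permutation:
  assumes V: "V \<subseteq> {1..n}" and A: "A \<subseteq> {1..n}" "1 \<in> A" and card: "card A = card V"
    and dom: "\<And>k. k \<in> {1..n} \<Longrightarrow> card (V \<inter> {..<k}) < card (A \<inter> {..k})"
  obtains p where "p \<in> permutations_of_set {1..n}" "avoids_312 p"
    "lr_positions p = A" "lr_values p = V"
proof
  let ?p = "build A V n"
  have p: "partial_perm A V n ?p"
    using partial_perm_build[OF assms, of n] by simp
  then show perm: "?p \<in> permutations_of_set {1..n}"
    unfolding partial_perm_def permutations_of_set_def
    by (simp add: card_subset_eq distinct_card)
  show "avoids_312 ?p"
    using p no_gap_avoids_312 by (auto simp: partial_perm_def)
  show pos: "lr_positions ?p = A"
    using p A by (auto simp: partial_perm_def lr_positions_def)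
  have "lr_values ?p \<subseteq> V"
    using p A unfolding lr_values_def pos by (auto simp: partial_perm_def)
  then show "lr_values ?p = V"
    using card_lr_values[of ?p] pos card V finite_subset[OF V]
    by (intro card_subset_eq) auto
qed

subsection \<open>Hook configurations as noncrossing matchings\<close>

text \<open>Here \<open>f d\<close> is the position of the northeast endpoint of the hook starting
  at \<open>d\<close>. The last clause is noncrossing of the arcs from \<open>d\<close> to
  \<open>f d\<close>; its strict bound \<open>d' < f d\<close> leaves \<open>d' = f d\<close> free,
  as hooks may touch there.\<close>

definition matching :: "nat set \<Rightarrow> nat set \<Rightarrow> (nat \<Rightarrow> nat) \<Rightarrow> bool" where
  "matching Ds L f \<longleftrightarrow> (\<forall>d\<in>Ds. d < f d \<and> f d \<in> L) \<and> inj_on f Ds \<and>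
     (\<forall>d\<in>Ds. \<forall>d'\<in>Ds. d < d' \<and> d' < f d \<longrightarrow> f d' < f d)"

text \<open>The value at \<open>d\<close> is forced by the values to the right of \<open>d\<close>: it is the least element of the
  image beyond \<open>d\<close> that is still free, as using a later one would produce a crossing.\<close>

lemma matching_unique:
  assumes f: "matching Ds L f" and g: "matching Ds L g" and im: "f ` Ds = g ` Ds"
    and fin: "finite Ds" and "d \<in> Ds"
  shows "f d = g d"
proof (rule ccontr)
  \<comment> \<open>Stated for arbitrary \<open>f\<close> and \<open>g\<close> so that it applies
    with the two exchanged. The \<open>e\<close> below starts the arc of \<open>g\<close> ending at
    \<open>f d\<close>; for \<open>e < d\<close> the arcs of \<open>g\<close> from \<open>e\<close>
    and \<open>d\<close> would cross.\<close>
  have le: "g d \<le> f d" if f: "matching Ds L f" and g: "matching Ds L g" and im: "f ` Ds = g ` Ds"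
      and d: "d \<in> Ds" and eq: "\<And>e. e \<in> Ds \<Longrightarrow> d < e \<Longrightarrow> f e = g e" for f g d
  proof (rule ccontr)
    assume less: "\<not> g d \<le> f d"
    from im d obtain e where e: "e \<in> Ds" "f d = g e" by (metis imageE imageI)
    have "e \<noteq> d" using e less by auto
    then consider "d < e" | "e < d" by linarith
    then show False
    proof cases
      case 1
      then have "f e = f d" using eq e by simp
      then show False using f d e \<open>e \<noteq> d\<close> by (auto simp: matching_def inj_on_def)
    next
      case 2
      moreover have "d < g e" using f d e by (auto simp: matching_def)
      ultimately have "g d < g e" using g d e by (auto simp: matching_def)
      then show False using e less by simp
    qed
  qed
  let ?B = "{d \<in> Ds. f d \<noteq> g d}"
  assume "f d \<noteq> g d"
  then have ne: "?B \<noteq> {}" "finite ?B" using \<open>d \<in> Ds\<close> fin by auto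
  define m where "m = Max ?B"
  have m: "m \<in> Ds" "f m \<noteq> g m" using Max_in[OF ne(2,1)] by (auto simp: m_def)
  have "f e = g e" if "e \<in> Ds" "m < e" for e
    using that Max_ge[OF ne(2), of e] by (force simp: m_def)
  with le[OF f g im m(1)] le[OF g f im[symmetric] m(1)] m(2) show False by force
qed

text \<open>Descents are added from right to left, each taking the least free element of
  \<open>S\<close> beyond it; the hypothesis at the new \<open>d\<close> leaves one, since it counts
  \<open>d\<close> besides all of \<open>Ds\<close>. The extra conclusion, that no arc passes over a
  free element of \<open>S\<close>, carries the induction: it prevents crossings with the next
  arc.\<close>

lemma matching_exists_greedy:
  assumes "finite Ds" "finite S" "\<And>d. d \<in> Ds \<Longrightarrow> card {e \<in> Ds. d \<le> e} \<le> card {s \<in> S. d < s}"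
  shows "\<exists>f. matching Ds S f \<and> (\<forall>d\<in>Ds. \<forall>s\<in>S. d < s \<and> s < f d \<longrightarrow> s \<in> f ` Ds)"
  using assms(1,3)
proof (induction Ds rule: finite_linorder_min_induct)
  case empty
  then show ?case by (simp add: matching_def)
next
  case (insert d Ds)
  have "card {e \<in> Ds. d' \<le> e} \<le> card {s \<in> S. d' < s}" if "d' \<in> Ds" for d'
  proof -
    have "{e \<in> insert d Ds. d' \<le> e} = {e \<in> Ds. d' \<le> e}"
      using insert.hyps(2) that by auto
    with insert.prems[of d'] that show ?thesis by simp
  qed
  from insert.IH[OF this] obtain f where f: "matching Ds S f"
    and greedy: "\<And>d s. d \<in> Ds \<Longrightarrow> s \<in> S \<Longrightarrow> d < s \<Longrightarrow> s < f d \<Longrightarrow> s \<in> f ` Ds" by blast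
  have dD: "d \<notin> Ds" using insert.hyps(2) by auto
  have "{e \<in> insert d Ds. d \<le> e} = insert d Ds"
    using insert.hyps(2) by auto
  with insert.prems[of d] dD insert.hyps(1) have "card (f ` Ds) < card {s \<in> S. d < s}"
    using card_image_le[OF insert.hyps(1), of f] by simp
  then have "\<not> {s \<in> S. d < s} \<subseteq> f ` Ds"
    using insert.hyps(1) by (meson card_mono finite_imageI not_less)
  then have ne: "{s \<in> S. d < s \<and> s \<notin> f ` Ds} \<noteq> {}" (is "?F \<noteq> {}") by auto
  define m where "m = Min ?F"
  have finF: "finite ?F" using assms(2) by simp
  have m: "m \<in> S" "d < m" "m \<notin> f ` Ds"
    using Min_in[OF finF ne] by (auto simp: m_def)
  have m_min: "s \<in> f ` Ds" if "s \<in> S" "d < s" "s < m" for s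
    using that Min_le[OF finF, of s] by (force simp: m_def)
  let ?g = "f(d := m)"
  have im: "?g ` Ds = f ` Ds" using dD by auto
  have "matching (insert d Ds) S ?g"
    unfolding matching_def
  proof (intro conjI ballI impI)
    show "inj_on ?g (insert d Ds)"
      using f m dD by (auto simp: matching_def inj_on_def)
    fix e assume e: "e \<in> insert d Ds"
    show "e < ?g e" "?g e \<in> S" using f m e dD by (auto simp: matching_def)
    fix e' assume e': "e' \<in> insert d Ds" "e < e' \<and> e' < ?g e"
    then have "e' \<in> Ds" "e' \<noteq> d" using insert.hyps(2) e by auto
    show "?g e' < ?g e"
    proof (cases "e = d")
      case True
      have "f e' \<noteq> m" using m \<open>e' \<in> Ds\<close> by auto
      \<comment> \<open>An arc from \<open>e'\<close> ending beyond \<open>m\<close> would have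
        passed over the free element \<open>m\<close>.\<close>
      moreover have "\<not> m < f e'"
        using greedy[of e' m] m \<open>e' \<in> Ds\<close> e' True by auto
      ultimately show ?thesis using True \<open>e' \<noteq> d\<close> by simp
    next
      case False
      with f e e' \<open>e' \<in> Ds\<close> \<open>e' \<noteq> d\<close> show ?thesis by (auto simp: matching_def)
    qed
  qed
  moreover have "s \<in> ?g ` insert d Ds"
    if "e \<in> insert d Ds" "s \<in> S" "e < s \<and> s < ?g e" for e s
    using that greedy[of e s] m_min[of s] im by (cases "e = d") auto
  ultimately show ?case by blast
qed

lemma matching_exists:
  assumes "finite Ds" "finite S" "card Ds = card S"
    "\<And>d. d \<in> Ds \<Longrightarrow> card {e \<in> Ds. d \<le> e} \<le> card {s \<in> S. d < s}"
  obtains f where "matching Ds S f" "f ` Ds = S"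
proof -
  obtain f where f: "matching Ds S f"
    using matching_exists_greedy[OF assms(1,2,4)] by blast
  have "f ` Ds = S"
    using f assms by (intro card_subset_eq) (auto simp: matching_def card_image)
  with f that show ?thesis by blast
qed

lemma matching_ballot:
  assumes f: "matching Ds L f" and fin: "finite Ds"
  shows "card {d \<in> Ds. k \<le> d} \<le> card {s \<in> f ` Ds. k < s}"
proof (rule card_inj_on_le)
  show "inj_on f {d \<in> Ds. k \<le> d}"
    using f by (auto simp: matching_def inj_on_def)
  show "f ` {d \<in> Ds. k \<le> d} \<subseteq> {s \<in> f ` Ds. k < s}"
    using f by (auto simp: matching_def intro: le_less_trans)
qed (use fin in simp)

section \<open>Hook drawings versus matchings\<close>

lemma plot_point_eq_iff [simp]: "plot_point p i = plot_point p j \<longleftrightarrow> i = j"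
  by (auto simp: plot_point_def)

lemma mem_hook_drawing:
  assumes "is_hook p H"
  shows "(x, y) \<in> hook_drawing p H \<longleftrightarrow>
    x = real (fst H) \<and> real (entry p (fst H)) \<le> y \<and> y \<le> real (entry p (snd H)) \<or>
    real (fst H) \<le> x \<and> x \<le> real (snd H) \<and> y = real (entry p (snd H))"
  by (auto simp: hook_drawing_def southwest_def northeast_def plot_point_def)

lemma lr_max_ge:
  assumes "j \<in> lr_positions p" "1 \<le> i" "i \<le> j"
  shows "entry p i \<le> entry p j"
  using assms by (cases "i = j") (auto simp: lr_positions_def is_lr_max_def less_imp_le)

lemma distinct_descents: "distinct (descents p)"
  by (simp add: descents_def)

text \<open>As no point lies above a hook, its northeast endpoint is at least as high as every entry
  from \<open>d\<close> to \<open>f d\<close>; a higher entry left of \<open>d\<close> would form a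
  312 with \<open>d\<close> and \<open>f d\<close>. So \<open>f d\<close> is a record. The
  intersection condition yields the rest: two hooks cannot share a northeast endpoint, and crossing
  arcs would give crossing drawings.\<close>

lemma is_vhc_imp_matching:
  assumes av: "avoids_312 p" and dist: "distinct p" and vhc: "is_vhc p Hs"
  obtains f where "matching (set (descents p)) (lr_positions p) f"
    "Hs = map (\<lambda>d. (d, f d)) (descents p)"
proof -
  have fst: "map fst Hs = descents p"
  proof (rule nth_equalityI)
    show "length (map fst Hs) = length (descents p)"
      using vhc by (simp add: is_vhc_def)
    fix i assume i: "i < length (map fst Hs)"
    then have "plot_point p (fst (Hs ! i)) = plot_point p (descents p ! i)"
      using vhc by (simp add: is_vhc_def southwest_def)
    with i show "map fst Hs ! i = descents p ! i" by simp
  qed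
  define f where "f d = the (map_of Hs d)" for d
  have "map_of Hs (fst H) = Some (snd H)" if "H \<in> set Hs" for H
    using that fst distinct_descents[of p] by (intro map_of_is_SomeI) auto
  then have "map (\<lambda>H. (fst H, f (fst H))) Hs = Hs"
    by (intro map_idI) (auto simp: f_def)
  moreover have "map (\<lambda>d. (d, f d)) (map fst Hs) = map (\<lambda>H. (fst H, f (fst H))) Hs" by simp
  ultimately have Hs: "Hs = map (\<lambda>d. (d, f d)) (descents p)" using fst by simp
  let ?Ds = "set (descents p)"
  have mem: "(d, f d) \<in> set Hs" if "d \<in> ?Ds" for d
    using that Hs by (metis (no_types, lifting) image_eqI list.set_map)
  have hook: "is_hook p (d, f d)" if "d \<in> ?Ds" for d
    using vhc mem[OF that] by (auto simp: is_vhc_def)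
  have below: "entry p k \<le> entry p (f d)" if d: "d \<in> ?Ds" and k: "d \<le> k" "k \<le> f d" for d k
  proof -
    have "k \<in> {1..length p}" using hook[OF d] k by (auto simp: is_hook_def)
    then have "plot_point p k \<in> plot p" by (simp add: plot_def)
    then have "\<not> (\<exists>Q\<in>hook_drawing p (d, f d). fst Q = fst (plot_point p k) \<and>
        snd Q < snd (plot_point p k))"
      using vhc mem[OF d] unfolding is_vhc_def by blast
    moreover have "(real k, real (entry p (f d))) \<in> hook_drawing p (d, f d)"
      using k by (simp add: mem_hook_drawing[OF hook[OF d]])
    ultimately show ?thesis by (force simp: plot_point_def)
  qed
  have max: "f d \<in> lr_positions p" if d: "d \<in> ?Ds" for d
  proof (rule ccontr)
    assume *: "f d \<notin> lr_positions p"
    have h: "1 \<le> d" "d < f d" "f d \<le> length p" "entry p d < entry p (f d)"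
      using hook[OF d] by (auto simp: is_hook_def)
    with * obtain k where k: "1 \<le> k" "k < f d" "entry p (f d) \<le> entry p k"
      by (auto simp: lr_positions_def is_lr_max_def not_less)
    have "entry p k \<noteq> entry p (f d)"
      using inj_onD[OF entry_inj_on[OF dist], of k "f d"] k h by auto
    with k have less: "entry p (f d) < entry p k" by simp
    then have "k < d" using below[OF d, of k] k by force
    with av k h less show False unfolding avoids_312_def by blast
  qed
  have cross: "P = northeast p (d, f d) \<and> P = southwest p (d', f d') \<or>
      P = northeast p (d', f d') \<and> P = southwest p (d, f d)"
    if d: "d \<in> ?Ds" "d' \<in> ?Ds" "d \<noteq> d'"
      and P: "P \<in> hook_drawing p (d, f d)" "P \<in> hook_drawing p (d', f d')" for d d' P
  proof -
    obtain i j where ij: "i < length Hs" "j < length Hs" "Hs ! i = (d, f d)" "Hs ! j = (d', f d')"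
      using mem[OF d(1)] mem[OF d(2)] by (auto simp: in_set_conv_nth)
    with d have "i \<noteq> j" by auto
    then have "\<forall>P\<in>hook_drawing p (Hs ! i) \<inter> hook_drawing p (Hs ! j).
           P = northeast p (Hs ! i) \<and> P = southwest p (Hs ! j) \<or>
           P = northeast p (Hs ! j) \<and> P = southwest p (Hs ! i)"
      using vhc ij(1,2) unfolding is_vhc_def by blast
    with P ij show ?thesis by auto
  qed
  have lt: "d < f d" if "d \<in> ?Ds" for d using hook[OF that] by (simp add: is_hook_def)
  have inj: "inj_on f ?Ds"
  proof (rule inj_onI, rule ccontr)
    fix d d' assume d: "d \<in> ?Ds" "d' \<in> ?Ds" "f d = f d'" "d \<noteq> d'"
    have "plot_point p (f d) \<in> hook_drawing p (e, f e)" if "e \<in> ?Ds" "f e = f d" for e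
      using lt[OF that(1)] that(2)
        mem_hook_drawing[OF hook[OF that(1)], of "real (f d)" "real (entry p (f d))"]
      by (simp add: plot_point_def)
    with cross[OF d(1,2,4), of "plot_point p (f d)"] d lt[OF d(1)] lt[OF d(2)] show False
      by (auto simp: southwest_def)
  qed
  have "f d' < f d" if d: "d \<in> ?Ds" "d' \<in> ?Ds" "d < d'" "d' < f d" for d d'
  proof (rule ccontr)
    assume "\<not> f d' < f d"
    then have "entry p (f d) \<le> entry p (f d')"
      using lr_max_ge[OF max[OF d(2)], of "f d"] d hook[OF d(1)] by (auto simp: is_hook_def)
    moreover have "entry p d' \<le> entry p (f d)"
      using below[OF d(1), of d'] d by simp
    \<comment> \<open>At this point the vertical segment over \<open>d'\<close> would meet the
      horizontal segment of the hook from \<open>d\<close>.\<close>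
    ultimately have "(real d', real (entry p (f d))) \<in> hook_drawing p (d', f d')"
      by (simp add: mem_hook_drawing[OF hook[OF d(2)]])
    moreover have "(real d', real (entry p (f d))) \<in> hook_drawing p (d, f d)"
      using d by (simp add: mem_hook_drawing[OF hook[OF d(1)]])
    ultimately show False
      using cross[OF d(1,2), of "(real d', real (entry p (f d)))"] d lt[OF d(2)]
      by (auto simp: northeast_def plot_point_def)
  qed
  then have "matching ?Ds (lr_positions p) f"
    unfolding matching_def using lt max inj by blast
  with Hs that show ?thesis by blast
qed

text \<open>No point lies above a hook because \<open>f d\<close> is a record. For
  \<open>d < d'\<close>, a common point of the two drawings has abscissa at least \<open>d'\<close>
  and so lies on the horizontal segment of the hook from \<open>d\<close>. If
  \<open>d' < f d\<close>, nesting and the increase of records put the whole hook from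
  \<open>d'\<close> strictly below that segment. Only the permitted contact \<open>d' = f d\<close>
  remains.\<close>

lemma matching_imp_is_vhc:
  assumes f: "matching (set (descents p)) (lr_positions p) f"
  shows "is_vhc p (map (\<lambda>d. (d, f d)) (descents p))"
proof -
  let ?Ds = "set (descents p)"
  have Ds: "1 \<le> d" "d < f d" "f d \<in> lr_positions p" if "d \<in> ?Ds" for d
    using f that by (auto simp: matching_def descents_def)
  have hook: "is_hook p (d, f d)" if "d \<in> ?Ds" for d
    using Ds[OF that] by (auto simp: is_hook_def lr_positions_def is_lr_max_def)
  have cross: "P = northeast p (d, f d) \<and> P = southwest p (d', f d')"
    if d: "d \<in> ?Ds" "d' \<in> ?Ds" "d < d'"
      and P: "P \<in> hook_drawing p (d, f d)" "P \<in> hook_drawing p (d', f d')" for d d' P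
  proof -
    obtain x y where xy: "P = (x, y)" by fastforce
    note P' = P[unfolded xy mem_hook_drawing[OF hook[OF d(1)]] mem_hook_drawing[OF hook[OF d(2)]]]
    have x: "real d' \<le> x" using P'(2) by auto
    then have y: "x \<le> real (f d)" "y = real (entry p (f d))" using P'(1) d(3) by auto
    have "\<not> d' < f d"
    proof
      assume "d' < f d"
      with f d have "f d' < f d" by (auto simp: matching_def)
      then have "entry p (f d') < entry p (f d)"
        using lr_max_mono[of "f d'" p "f d"] Ds(3)[OF d(1)] Ds(3)[OF d(2)] by simp
      moreover have "y \<le> real (entry p (f d'))" using P'(2) by auto
      ultimately show False using y by simp
    qed
    with x y have "d' = f d" "x = real d'" by linarith+
    with xy y show ?thesis by (auto simp: northeast_def southwest_def plot_point_def)
  qed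
  show ?thesis
    unfolding is_vhc_def
  proof (intro conjI ballI allI impI notI)
    fix H assume "H \<in> set (map (\<lambda>d. (d, f d)) (descents p))"
    then obtain d where d: "d \<in> ?Ds" "H = (d, f d)" by auto
    then show "is_hook p H" using hook by simp
    fix P assume "P \<in> plot p" "\<exists>Q\<in>hook_drawing p H. fst Q = fst P \<and> snd Q < snd P"
    then obtain k y where k: "k \<in> {1..length p}" "(real k, y) \<in> hook_drawing p H"
      "y < real (entry p k)"
      by (auto simp: plot_def plot_point_def)
    then show False
      unfolding d(2) mem_hook_drawing[OF hook[OF d(1)]]
      using lr_max_ge[OF Ds(3)[OF d(1)], of k] by auto
  next
    fix i j P
    let ?Hs = "map (\<lambda>d. (d, f d)) (descents p)"
    assume ij: "i < length ?Hs" "j < length ?Hs" "i \<noteq> j"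
      and P: "P \<in> hook_drawing p (?Hs ! i) \<inter> hook_drawing p (?Hs ! j)"
    have "descents p ! i \<noteq> descents p ! j"
      using ij nth_eq_iff_index_eq[OF distinct_descents] by auto
    then consider "descents p ! i < descents p ! j" | "descents p ! j < descents p ! i"
      by linarith
    then show "P = northeast p (?Hs ! i) \<and> P = southwest p (?Hs ! j) \<or>
           P = northeast p (?Hs ! j) \<and> P = southwest p (?Hs ! i)"
      using cross[of "descents p ! i" "descents p ! j" P]
        cross[of "descents p ! j" "descents p ! i" P] ij P
      by cases auto
  qed (auto simp: southwest_def)
qed

text \<open>Otherwise \<open>length p - 1\<close> is a descent, and the only position beyond it is
  not a record, so its arc has no end.\<close>

lemma matching_last_lr_position:
  assumes "avoids_312 p" "distinct p" "p \<noteq> []"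
    and f: "matching (set (descents p)) (lr_positions p) f"
  shows "length p \<in> lr_positions p"
proof (rule ccontr)
  assume *: "length p \<notin> lr_positions p"
  then have "length p \<noteq> 1" using one_in_lr_positions[OF assms(3)] by auto
  with * assms(3) have d: "length p - 1 \<in> set (descents p)"
    by (cases "length p") (auto simp: descent_iff[OF assms(1,2)] Suc_le_eq)
  then have "length p - 1 < f (length p - 1)" "f (length p - 1) \<in> lr_positions p"
    using f by (auto simp: matching_def)
  moreover from this have "f (length p - 1) \<le> length p" by (simp add: lr_positions_def)
  ultimately have "f (length p - 1) = length p" by linarith
  with * \<open>f (length p - 1) \<in> lr_positions p\<close> show False by simp
qed

subsection \<open>Motzkin words\<close>

abbreviation nonD :: "step list \<Rightarrow> step list" where
  "nonD \<equiv> filter (\<lambda>x. x \<noteq> D)"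

lemma word_eqI:
  assumes "nonD w = nonD w'" "map (\<lambda>x. x = D) w = map (\<lambda>x. x = D) w'"
  shows "w = w'"
proof -
  have "length w = length w'" using assms(2) by (metis length_map)
  then show ?thesis
    using assms by (induction w w' rule: list_induct2) (auto split: if_splits)
qed

lemma nonD_path_word:
  assumes "length Xs = length gs" "D \<notin> set Xs"
  shows "nonD (path_word Xs gs) = Xs"
  using assms by (induction Xs gs rule: list_induct2) auto

lemma set_nonD: "set (nonD w) \<subseteq> {U, E}"
  using step.exhaust by auto

lemma path_class_motzkin:
  assumes "w \<in> motzkin n"
  shows "path_class w = {j \<in> {1..length (nonD w)}. nonD w ! (j - 1) = E}"
proof -
  obtain Xs gs where d: "decomposition w Xs gs"
    using motzkin_decomposition[OF assms] by blast
  then have "nonD w = Xs"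
    by (auto simp: decomposition_def intro!: nonD_path_word)
  with d decomposition_unique[OF d] show ?thesis
    unfolding path_class_def by blast
qed

lemma count_nonD: "c \<noteq> D \<Longrightarrow> count_list w c = count_list (nonD w) c"
  by (induction w) auto

lemma count_D: "count_list w D + length (nonD w) = length w"
  by (induction w) auto

lemma length_nonD: "length (nonD w) = count_list w U + count_list w E"
proof (induction w)
  case (Cons a w)
  then show ?case by (cases a) auto
qed simp

text \<open>The class gives the places of the \<open>E\<close>s, but not at once the number of
  letters other than \<open>D\<close>. For a Motzkin word this follows from
  \<open>2 * #U + #E = n\<close>, with \<open>#E\<close> the size of the class; every remaining
  letter is then a \<open>U\<close>.\<close>

lemma path_class_eq_iff:
  assumes w: "w \<in> motzkin n" and w': "w' \<in> motzkin n"
  shows "path_class w = path_class w' \<longleftrightarrow> nonD w = nonD w'"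
proof
  assume eq: "path_class w = path_class w'"
  have E_count: "count_list v E = card (path_class v)" if "v \<in> motzkin n" for v
  proof -
    have "count_list v E = length (filter (\<lambda>x. x = E) (nonD v))"
      unfolding count_list_eq_length_filter filter_filter
      by (rule arg_cong[of _ _ length], rule filter_cong) auto
    also have "\<dots> = card {i. i < length (nonD v) \<and> nonD v ! i = E}"
      by (simp only: length_filter_conv_card)
    also have "\<dots> = card (Suc ` {i. i < length (nonD v) \<and> nonD v ! i = E})"
      by (simp add: card_image)
    also have "Suc ` {i. i < length (nonD v) \<and> nonD v ! i = E} = path_class v"
      unfolding path_class_motzkin[OF that]
    proof (rule set_eqI)
      fix j
      show "j \<in> Suc ` {i. i < length (nonD v) \<and> nonD v ! i = E} \<longleftrightarrow>
        j \<in> {j \<in> {1..length (nonD v)}. nonD v ! (j - 1) = E}"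
        by (cases j) (simp_all add: image_iff Suc_le_eq)
    qed
    finally show ?thesis .
  qed
  have half: "2 * count_list v U + count_list v E = n" if "v \<in> motzkin n" for v
    using that count_D[of v] length_nonD[of v] by (auto simp: motzkin_def)
  have "count_list w E = count_list w' E"
    using E_count[OF w] E_count[OF w'] eq by simp
  then have len: "length (nonD w) = length (nonD w')"
    using half[OF w] half[OF w'] by (simp add: length_nonD)
  show "nonD w = nonD w'"
  proof (rule nth_equalityI[OF len])
    fix i assume i: "i < length (nonD w)"
    then have "nonD w ! i = E \<longleftrightarrow> nonD w' ! i = E"
      using eq[unfolded path_class_motzkin[OF w] path_class_motzkin[OF w'], THEN eqset_imp_iff,
          of "Suc i"] len by (simp add: Suc_le_eq)
    moreover have "nonD w ! i \<in> {U, E}" "nonD w' ! i \<in> {U, E}"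
      using subsetD[OF set_nonD nth_mem[OF i]] subsetD[OF set_nonD nth_mem, of i w'] i len
      by simp_all
    ultimately show "nonD w ! i = nonD w' ! i" by auto
  qed
qed (simp add: path_class_motzkin[OF w] path_class_motzkin[OF w'])

section \<open>Prefix heights and the order via letters other than \<open>D\<close>\<close>

lemma height_take:
  assumes "i \<le> length w"
  defines "m \<equiv> length (nonD (take i w))"
  shows "height (take i w) = int (count_list (take m (nonD w)) U) + int m - int i"
proof -
  have "nonD w = nonD (take i w) @ nonD (drop i w)"
    by (metis append_take_drop_id filter_append)
  then have "take m (nonD w) = nonD (take i w)"
    by (simp add: m_def)
  then have "count_list (take i w) U = count_list (take m (nonD w)) U"
    using count_nonD[of U "take i w"] by simp
  moreover have "count_list (take i w) D + m = i"
    using count_D[of "take i w"] assms by simp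
  ultimately show ?thesis by (simp add: height_def)
qed

lemma count_list_take_mono: "m \<le> m' \<Longrightarrow> count_list (take m xs) c \<le> count_list (take m' xs) c"
  by (metis count_list_append le_add1 le_Suc_ex take_add)

text \<open>By \<open>height_take\<close>, the height is the number of \<open>U\<close>s among the
  first \<open>m\<close> letters of \<open>nonD w\<close>, plus \<open>m - i\<close>. For fixed
  \<open>nonD w\<close> and \<open>i\<close> this is strictly increasing in
  \<open>m\<close>.\<close>

lemma height_take_le_iff:
  assumes "nonD w = nonD w'" "i \<le> length w" "i \<le> length w'"
  shows "height (take i w) \<le> height (take i w') \<longleftrightarrow>
    length (nonD (take i w)) \<le> length (nonD (take i w'))"
  unfolding height_take[OF assms(2)] height_take[OF assms(3)] assms(1)
  using count_list_take_mono[of "length (nonD (take i w))" "length (nonD (take i w'))" "nonD w'" U]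
    count_list_take_mono[of "length (nonD (take i w'))" "length (nonD (take i w))" "nonD w'" U]
  by linarith

text \<open>On the right only \<open>w\<close> has to be Motzkin: \<open>w'\<close> inherits its
  letter counts from the common length and \<open>nonD\<close>, and its nonnegative prefix heights
  from lying above \<open>w\<close>.\<close>

lemma motzkin_C_iff:
  "(w, w') \<in> motzkin_C n \<longleftrightarrow> w \<in> motzkin n \<and> length w' = n \<and> nonD w = nonD w' \<and>
     (\<forall>i\<le>n. length (nonD (take i w)) \<le> length (nonD (take i w')))"
proof
  assume "(w, w') \<in> motzkin_C n"
  then have w: "w \<in> motzkin n" "w' \<in> motzkin n" and eq: "nonD w = nonD w'"
    and le: "\<And>i. i \<in> {1..n} \<Longrightarrow> height (take i w) \<le> height (take i w')"
    using path_class_eq_iff by (auto simp: motzkin_C_def motzkin_S_def)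
  have "length (nonD (take i w)) \<le> length (nonD (take i w'))" if "i \<le> n" for i
    using le[of i] height_take_le_iff[OF eq, of i] w that by (cases "i = 0") (auto simp: motzkin_def)
  with w eq show "w \<in> motzkin n \<and> length w' = n \<and> nonD w = nonD w' \<and>
     (\<forall>i\<le>n. length (nonD (take i w)) \<le> length (nonD (take i w')))"
    by (auto simp: motzkin_def)
next
  assume *: "w \<in> motzkin n \<and> length w' = n \<and> nonD w = nonD w' \<and>
     (\<forall>i\<le>n. length (nonD (take i w)) \<le> length (nonD (take i w')))"
  then have w: "w \<in> motzkin n" "length w' = n" "length w = n" and eq: "nonD w = nonD w'"
    and le: "\<And>i. i \<le> n \<Longrightarrow> height (take i w) \<le> height (take i w')"
    using height_take_le_iff[of w w'] by (auto simp: motzkin_def)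
  have "count_list w' U = count_list w U" "count_list w' D = count_list w D"
    using eq count_nonD[of U w] count_nonD[of U w'] count_D[of w] count_D[of w'] w by auto
  moreover have "count_list (take i w') D \<le> count_list (take i w') U" if "i \<le> n" for i
  proof -
    have "count_list (take i w) D \<le> count_list (take i w) U"
      using w that by (auto simp: motzkin_def)
    then have "0 \<le> height (take i w)" by (simp add: height_def)
    with le[OF that] show ?thesis by (simp add: height_def)
  qed
  ultimately have "w' \<in> motzkin n"
    using w by (simp add: motzkin_def)
  with w eq le show "(w, w') \<in> motzkin_C n"
    by (auto simp: motzkin_C_def motzkin_S_def path_class_eq_iff)
qed

lemma motzkin_C_subset: "motzkin_C n \<subseteq> motzkin n \<times> motzkin n"
  by (auto simp: motzkin_C_def motzkin_S_def)

lemma intervals_motzkin_C: "intervals (motzkin n) (motzkin_C n) = motzkin_C n"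
  using motzkin_C_subset by (auto simp: intervals_def)

section \<open>Words read off sets of positions\<close>

lemma path_word_append:
  "length Xs = length gs \<Longrightarrow> path_word (Xs @ Ys) (gs @ hs) = path_word Xs gs @ path_word Ys hs"
  by (simp add: path_word_def)

text \<open>Label the letters by \<open>a 0\<close> down to \<open>a l + 1\<close>. Then
  \<open>X i\<close> receives the label \<open>a (i - 1)\<close>, and the \<open>D\<close>s after it
  fill the gap strictly between \<open>a (i - 1)\<close> and \<open>a i\<close>. This serves both
  words, with record positions and record heights as \<open>a\<close>.\<close>

lemma D_positions_path_word:
  fixes a :: "nat \<Rightarrow> nat"
  assumes "strict_antimono_on {..l} a" "\<And>i. i \<in> {1..l} \<Longrightarrow> X i \<noteq> D"
  shows "map (\<lambda>x. x = D) (path_word (map X [1..<l + 1]) (map (\<lambda>i. a (i - 1) - a i - 1) [1..<l + 1]))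
    = map (\<lambda>x. x \<notin> a ` {..<l}) (rev [a l + 1..<a 0 + 1])"
  using assms
proof (induction l)
  case (Suc l)
  have anti: "a j < a i" if "i < j" "j \<le> Suc l" for i j
    using Suc.prems(1) that by (auto simp: monotone_on_def)
  have "map (\<lambda>x. x = D) (path_word (map X [1..<l + 1]) (map (\<lambda>i. a (i - 1) - a i - 1) [1..<l + 1]))
    = map (\<lambda>x. x \<notin> a ` {..<l}) (rev [a l + 1..<a 0 + 1])"
    using Suc.prems by (intro Suc.IH) (auto simp: monotone_on_def)
  also have "\<dots> = map (\<lambda>x. x \<notin> a ` {..<Suc l}) (rev [a l + 1..<a 0 + 1])"
    by (auto simp: lessThan_Suc)
  finally have IH: "map (\<lambda>x. x = D) (path_word (map X [1..<l + 1])
      (map (\<lambda>i. a (i - 1) - a i - 1) [1..<l + 1]))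
    = map (\<lambda>x. x \<notin> a ` {..<Suc l}) (rev [a l + 1..<a 0 + 1])" .
  have le: "a (Suc l) < a l" "a l \<le> a 0"
    using anti[of l "Suc l"] anti[of 0 l] by (cases l; auto)+
  have "[a (Suc l) + 1..<a 0 + 1] = [a (Suc l) + 1..<a l + 1] @ [a l + 1..<a 0 + 1]"
    using le by (metis Suc_eq_plus1 Suc_le_mono less_imp_le_nat upt_add_eq_append le_add_diff_inverse)
  also have "[a (Suc l) + 1..<a l + 1] = [a (Suc l) + 1..<a l] @ [a l]"
    using le by simp
  finally have upt: "rev [a (Suc l) + 1..<a 0 + 1]
    = rev [a l + 1..<a 0 + 1] @ a l # rev [a (Suc l) + 1..<a l]"
    by simp
  have "x \<notin> a ` {..<Suc l}" if "x \<in> {a (Suc l) + 1..<a l}" for x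
  proof
    assume "x \<in> a ` {..<Suc l}"
    then obtain i where "i < Suc l" "x = a i" by blast
    then have "a l \<le> x" using anti[of i l] by (cases "i = l") simp_all
    with that show False by simp
  qed
  then have "map (\<lambda>x. x \<notin> a ` {..<Suc l}) (rev [a (Suc l) + 1..<a l])
      = map (\<lambda>x. True) (rev [a (Suc l) + 1..<a l])"
    by (intro map_cong) auto
  also have "\<dots> = replicate (a l - a (Suc l) - 1) True"
    by (simp add: map_replicate_const)
  finally have seg: "map (\<lambda>x. x \<notin> a ` {..<Suc l}) (rev [a (Suc l) + 1..<a l])
      = replicate (a l - a (Suc l) - 1) True" .
  have "X (Suc l) \<noteq> D" using Suc.prems(2) by simp
  moreover have "path_word (map X [1..<Suc l + 1]) (map (\<lambda>i. a (i - 1) - a i - 1) [1..<Suc l + 1])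
    = path_word (map X [1..<l + 1]) (map (\<lambda>i. a (i - 1) - a i - 1) [1..<l + 1])
      @ X (Suc l) # replicate (a l - a (Suc l) - 1) D"
    by (simp add: path_word_append)
  ultimately show ?case
    unfolding upt using IH seg by simp
qed simp

declare upt_Suc [simp del]

lemma take_rev_upt: "i \<le> b - a \<Longrightarrow> take i (rev [a..<b]) = rev [b - i..<b]"
  by (cases "a \<le> b") (auto simp: take_rev)

lemma length_filter_rev_upt: "length (filter P (rev [a..<b])) = card {x \<in> {a..<b}. P x}"
  using distinct_length_filter[of "rev [a..<b]" P] by (simp add: Int_def conj_commute)

lemma length_nonD_positions:
  assumes "map (\<lambda>x. x = D) w = map (\<lambda>x. x \<notin> A) xs"
  shows "length (nonD w) = length (filter (\<lambda>x. x \<in> A) xs)"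
proof -
  have "length (nonD w) = length (filter Not (map (\<lambda>x. x = D) w))"
    by (simp add: filter_map o_def)
  also have "\<dots> = length (filter (\<lambda>x. x \<in> A) xs)"
    by (simp add: assms filter_map o_def)
  finally show ?thesis .
qed

text \<open>With \<open>k = n - i\<close>, the prefixes of length \<open>i\<close> cover positions
  \<open>k + 1\<close> to \<open>n\<close> and heights \<open>k\<close> to \<open>n - 1\<close>.
  Taking complements, the counts are \<open>|A| - |A \<inter> [1, k]|\<close> and
  \<open>|V| - 1 - |V \<inter> [1, k - 1]|\<close>. The 1 accounts for \<open>n\<close> in
  \<open>V\<close> and turns the weak inequality into a strict one.\<close>

lemma nonD_prefixes_iff_dominance:
  assumes w: "map (\<lambda>x. x = D) w = map (\<lambda>x. x \<notin> A) (rev [2..<n + 1])"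
    and w': "map (\<lambda>x. x = D) w' = map (\<lambda>x. x \<notin> V) (rev [1..<n])"
    and A: "A \<subseteq> {1..n}" and V: "V \<subseteq> {1..n}" "n \<in> V" and card: "card A = card V"
  shows "(\<forall>i\<le>n - 1. length (nonD (take i w)) \<le> length (nonD (take i w'))) \<longleftrightarrow>
    (\<forall>k\<in>{1..n}. card (V \<inter> {..<k}) < card (A \<inter> {..k}))"
proof -
  have fin: "finite A" "finite V" using A V finite_subset by blast+
  have n: "1 \<le> n" using V by auto
  have iff: "length (nonD (take i w)) \<le> length (nonD (take i w')) \<longleftrightarrow>
      card (V \<inter> {..<n - i}) < card (A \<inter> {..n - i})" if i: "i \<le> n - 1" for i
  proof -
    define k where "k = n - i"
    have k: "1 \<le> k" "k \<le> n" using i n by (auto simp: k_def)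
    have "map (\<lambda>x. x = D) (take i w) = map (\<lambda>x. x \<notin> A) (rev [k + 1..<n + 1])"
      using arg_cong[OF w, of "take i"] i n
      by (simp add: take_map take_rev_upt k_def Suc_diff_le)
    from length_nonD_positions[OF this]
    have l: "length (nonD (take i w)) = card {x \<in> {k + 1..<n + 1}. x \<in> A}"
      by (simp only: length_filter_rev_upt)
    have "map (\<lambda>x. x = D) (take i w') = map (\<lambda>x. x \<notin> V) (rev [k..<n])"
      using arg_cong[OF w', of "take i"] i n
      by (simp add: take_map take_rev_upt k_def)
    from length_nonD_positions[OF this]
    have l': "length (nonD (take i w')) = card {x \<in> {k..<n}. x \<in> V}"
      by (simp only: length_filter_rev_upt)
    have "A = {x \<in> {k + 1..<n + 1}. x \<in> A} \<union> (A \<inter> {..k})" using A by auto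
    then have "card A = card {x \<in> {k + 1..<n + 1}. x \<in> A} + card (A \<inter> {..k})"
      using card_Un_disjoint[of "{x \<in> {k + 1..<n + 1}. x \<in> A}" "A \<inter> {..k}"] fin by fastforce
    moreover have "V = insert n ({x \<in> {k..<n}. x \<in> V} \<union> (V \<inter> {..<k}))"
      using V k by auto
    then have "card V = Suc (card ({x \<in> {k..<n}. x \<in> V} \<union> (V \<inter> {..<k})))"
      using card_insert_disjoint[of "{x \<in> {k..<n}. x \<in> V} \<union> (V \<inter> {..<k})" n] k by simp
    then have "card V = Suc (card {x \<in> {k..<n}. x \<in> V} + card (V \<inter> {..<k}))"
      using card_Un_disjoint[of "{x \<in> {k..<n}. x \<in> V}" "V \<inter> {..<k}"] fin by fastforce
    ultimately show ?thesis using card l l' unfolding k_def by linarith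
  qed
  show ?thesis
  proof
    assume *: "\<forall>i\<le>n - 1. length (nonD (take i w)) \<le> length (nonD (take i w'))"
    show "\<forall>k\<in>{1..n}. card (V \<inter> {..<k}) < card (A \<inter> {..k})"
    proof
      fix k assume "k \<in> {1..n}"
      then have "n - k \<le> n - 1" "n - (n - k) = k" by auto
      with * iff[of "n - k"] show "card (V \<inter> {..<k}) < card (A \<inter> {..k})" by simp
    qed
  next
    assume *: "\<forall>k\<in>{1..n}. card (V \<inter> {..<k}) < card (A \<inter> {..k})"
    show "\<forall>i\<le>n - 1. length (nonD (take i w)) \<le> length (nonD (take i w'))"
      using iff * n by auto
  qed
qed

text \<open>Read from right to left, the positions \<open>n, \<dots>, 2\<close> of a permutation correspond to the letters of
  its first path. The positions in \<open>A\<close> are the left-to-right maxima, those in \<open>S\<close> the northeast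
  endpoints. Heights \<open>n - 1, \<dots>, 1\<close> correspond in the same way to the letters of the second path.\<close>

definition position_word :: "nat \<Rightarrow> nat set \<Rightarrow> nat set \<Rightarrow> step list" where
  "position_word n A S =
     map (\<lambda>x. if x \<notin> A then D else if x \<in> S then U else E) (rev [2..<n + 1])"

text \<open>The \<open>D\<close> belonging to a descent \<open>d\<close> stands at position
  \<open>d + 1\<close>. Thus the prefix covering the positions above \<open>k\<close> sees the
  elements of \<open>S\<close> greater than \<open>k\<close>, but the descents from \<open>k\<close>
  on.\<close>

lemma position_word_motzkin_iff:
  assumes "n \<ge> 1" and S: "S \<subseteq> A \<inter> {2..n}"
  defines "Ds \<equiv> {d. 1 \<le> d \<and> d < n \<and> d + 1 \<notin> A}"
  shows "position_word n A S \<in> motzkin (n - 1) \<longleftrightarrow>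
    card Ds = card S \<and> (\<forall>k\<in>{1..n}. card {d \<in> Ds. k \<le> d} \<le> card {s \<in> S. k < s})"
proof -
  let ?L = "\<lambda>x. if x \<notin> A then D else if x \<in> S then U else E"
  let ?w = "position_word n A S"
  have count: "count_list (map ?L (rev [a..<b])) c = card {x \<in> {a..<b}. ?L x = c}" for a b c
  proof -
    have "count_list (map ?L (rev [a..<b])) c = length (filter (\<lambda>x. ?L x = c) (rev [a..<b]))"
      unfolding count_list_eq_length_filter filter_map length_map
      by (rule arg_cong[of _ _ length], rule filter_cong) auto
    then show ?thesis by (simp only: length_filter_rev_upt)
  qed
  have U: "count_list (take i ?w) U = card {s \<in> S. n - i < s}"
    and D: "count_list (take i ?w) D = card {d \<in> Ds. n - i \<le> d}" if i: "i \<le> n - 1" for i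
  proof -
    have take: "take i ?w = map ?L (rev [n - i + 1..<n + 1])"
      using i assms(1) by (simp add: position_word_def take_map take_rev_upt Suc_diff_le)
    have "{x \<in> {n - i + 1..<n + 1}. ?L x = U} = {s \<in> S. n - i < s}"
      using S by auto
    then show "count_list (take i ?w) U = card {s \<in> S. n - i < s}"
      unfolding take count by simp
    have "{x \<in> {n - i + 1..<n + 1}. ?L x = D} = Suc ` {d \<in> Ds. n - i \<le> d}" (is "?X = ?Y")
    proof (rule set_eqI)
      fix x show "x \<in> ?X \<longleftrightarrow> x \<in> ?Y"
        using i assms(1) by (cases x) (auto simp: Ds_def image_iff)
    qed
    then show "count_list (take i ?w) D = card {d \<in> Ds. n - i \<le> d}"
      unfolding take count by (simp add: card_image)
  qed
  have len: "length ?w = n - 1" by (simp add: position_word_def)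
  have "{s \<in> S. n - (n - 1) < s} = S" "{d \<in> Ds. n - (n - 1) \<le> d} = Ds"
    using S assms(1) by (auto simp: Ds_def)
  then have tot: "count_list ?w U = card S" "count_list ?w D = card Ds"
    using U[of "n - 1"] D[of "n - 1"] len by simp_all
  have "(\<forall>i\<le>n - 1. count_list (take i ?w) D \<le> count_list (take i ?w) U) \<longleftrightarrow>
    (\<forall>k\<in>{1..n}. card {d \<in> Ds. k \<le> d} \<le> card {s \<in> S. k < s})"
  proof
    assume *: "\<forall>i\<le>n - 1. count_list (take i ?w) D \<le> count_list (take i ?w) U"
    show "\<forall>k\<in>{1..n}. card {d \<in> Ds. k \<le> d} \<le> card {s \<in> S. k < s}"
    proof
      fix k assume "k \<in> {1..n}"
      then have "n - k \<le> n - 1" "n - (n - k) = k" by auto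
      with * U[of "n - k"] D[of "n - k"]
      show "card {d \<in> Ds. k \<le> d} \<le> card {s \<in> S. k < s}" by metis
    qed
  next
    assume *: "\<forall>k\<in>{1..n}. card {d \<in> Ds. k \<le> d} \<le> card {s \<in> S. k < s}"
    show "\<forall>i\<le>n - 1. count_list (take i ?w) D \<le> count_list (take i ?w) U"
      using * U D assms(1) by auto
  qed
  then show ?thesis
    using tot len by (auto simp: motzkin_def)
qed

section \<open>The indexed list of left-to-right maxima\<close>

definition lr_list :: "nat list \<Rightarrow> nat list" where
  "lr_list p = rev (filter (is_lr_max p) [1..<length p + 1])"

lemma set_lr_list: "set (lr_list p) = lr_positions p"
  by (auto simp: lr_list_def lr_positions_def)

lemma lr_maxima_eq: "lr_maxima p = map (plot_point p) (lr_list p)"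
  by (simp add: lr_maxima_def lr_list_def)

lemma length_lr_list: "p \<noteq> [] \<Longrightarrow> length (lr_list p) = Suc (ell p)"
  using one_in_lr_positions[of p] set_lr_list[of p]
  by (cases "lr_list p") (auto simp: ell_def lr_maxima_eq)

lemma lr_list_less:
  assumes "i < j" "j < length (lr_list p)"
  shows "lr_list p ! j < lr_list p ! i"
proof -
  have "sorted_wrt (>) (lr_list p)"
    unfolding lr_list_def sorted_wrt_rev
    by (intro sorted_wrt_filter) (simp add: strict_sorted_iff)
  with assms show ?thesis by (simp add: sorted_wrt_iff_nth_less)
qed

lemma R_eq: "p \<noteq> [] \<Longrightarrow> i \<le> ell p \<Longrightarrow> R p i = plot_point p (lr_list p ! i)"
  using length_lr_list[of p]
  by (simp add: R_def lr_maxima_eq nth_append)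

lemma R_last: "p \<noteq> [] \<Longrightarrow> R p (Suc (ell p)) = (0, 0)"
  using length_lr_list[of p]
  by (simp add: R_def lr_maxima_eq nth_append)

lemma gam_eq:
  assumes "p \<noteq> []" "i \<in> {1..ell p}"
  shows "gam p i = lr_list p ! (i - 1) - lr_list p ! i - 1"
proof -
  have "lr_list p ! i \<in> lr_positions p" "lr_list p ! (i - 1) \<in> lr_positions p"
    unfolding set_lr_list[symmetric] using assms length_lr_list[of p]
    by (auto intro!: nth_mem)
  then have "{P \<in> plot p. fst (R p i) < fst P \<and> fst P < fst (R p (i - 1))} =
      plot_point p ` {lr_list p ! i<..<lr_list p ! (i - 1)}"
    using assms by (auto simp: R_eq plot_def plot_point_def lr_positions_def)
  then show ?thesis
    by (simp add: gam_def card_image inj_on_def)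
qed

lemma card_points_between_heights:
  assumes p: "p \<in> permutations_of_set {1..n}" and "b \<le> n"
  shows "card {P \<in> plot p. real a < snd P \<and> snd P < real b} = b - a - 1"
proof -
  let ?K = "{k \<in> {1..n}. a < entry p k \<and> entry p k < b}"
  note bij = permutation_entry_bij[OF p]
  have "{P \<in> plot p. real a < snd P \<and> snd P < real b} = plot_point p ` ?K"
    using permutation_length[OF p] by (auto simp: plot_def plot_point_def)
  then have "card {P \<in> plot p. real a < snd P \<and> snd P < real b} = card ?K"
    by (simp add: card_image inj_on_def)
  also have "\<dots> = card (entry p ` ?K)"
    by (intro card_image[symmetric] inj_on_subset[OF bij_betw_imp_inj_on[OF bij]]) auto
  also have "entry p ` ?K = {a<..<b}"
  proof (intro equalityI subsetI)
    fix v assume v: "v \<in> {a<..<b}"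
    then have "v \<in> entry p ` {1..n}"
      using bij_betw_imp_surj_on[OF bij] assms(2) by auto
    with v show "v \<in> entry p ` ?K" by auto
  qed auto
  finally show ?thesis by simp
qed

subsection \<open>The map in terms of positions and heights\<close>

context
  fixes p :: "nat list" and n :: nat
  assumes p: "p \<in> permutations_of_set {1..n}" and last: "n \<in> lr_positions p"
begin

private lemma len: "length p = n" and nonempty: "p \<noteq> []"
  using permutation_length[OF p] last by (auto simp: lr_positions_def)

private lemma lr_list_in: "i \<le> ell p \<Longrightarrow> lr_list p ! i \<in> lr_positions p"
  using length_lr_list[OF nonempty] by (simp flip: set_lr_list)

private lemma lr_positions_image: "lr_positions p = (!) (lr_list p) ` {..ell p}"
  using nth_image[of "length (lr_list p)" "lr_list p"] length_lr_list[OF nonempty]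
  by (simp add: set_lr_list lessThan_Suc_atMost atLeast0LessThan)

private lemma lr_list_0: "lr_list p ! 0 = n"
proof -
  obtain i where i: "i \<le> ell p" "n = lr_list p ! i"
    using last lr_positions_image by auto
  have "lr_list p ! 0 \<le> n" using lr_list_in[of 0] len by (simp add: lr_positions_def)
  with i lr_list_less[of 0 i p] length_lr_list[OF nonempty] show ?thesis
    by (cases "i = 0") auto
qed

private lemma lr_list_last: "lr_list p ! ell p = 1"
proof -
  obtain i where i: "i \<le> ell p" "1 = lr_list p ! i"
    using one_in_lr_positions[OF nonempty] lr_positions_image by auto
  have "1 \<le> lr_list p ! ell p" using lr_list_in[of "ell p"] by (simp add: lr_positions_def)
  with i lr_list_less[of i "ell p" p] length_lr_list[OF nonempty] show ?thesis
    by (cases "i = ell p") auto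
qed

lemma last_entry: "entry p n = n"
proof -
  have n: "n \<in> {1..n}" using last len by (simp add: lr_positions_def)
  then obtain x where x: "x \<in> {1..n}" "entry p x = n"
    using bij_betw_imp_surj_on[OF permutation_entry_bij[OF p]] by (metis imageE)
  then have "n \<le> entry p n" using lr_max_ge[OF last, of x] by simp
  moreover have "entry p n \<le> n" using bij_betwE[OF permutation_entry_bij[OF p]] n by auto
  ultimately show ?thesis by simp
qed

lemma n_in_lr_values: "n \<in> lr_values p"
  unfolding lr_values_def using imageI[OF last, of "entry p"] last_entry by simp

lemma lr_values_subset: "lr_values p \<subseteq> {1..n}"
proof -
  have "lr_positions p \<subseteq> {1..n}" using len by (auto simp: lr_positions_def)
  then show ?thesis
    using bij_betw_imp_surj_on[OF permutation_entry_bij[OF p]] unfolding lr_values_def by blast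
qed

private lemma second_value:
  assumes "1 \<le> ell p"
  shows "entry p (lr_list p ! 1) = n - 1"
proof -
  have "1 < n"
    using lr_list_less[of 0 "ell p" p] length_lr_list[OF nonempty] assms lr_list_0 lr_list_last
    by simp
  then have "n - 1 \<in> {1..n}" by simp
  then obtain x where x: "x \<in> {1..n}" "entry p x = n - 1"
    using bij_betw_imp_surj_on[OF permutation_entry_bij[OF p]] by (metis imageE)
  have xn: "x \<noteq> n" using x last_entry \<open>1 < n\<close> by auto
  have "is_lr_max p x"
    unfolding is_lr_max_def
  proof
    fix k assume k: "k \<in> {1..<x}"
    then have "k \<in> {1..n}" "k \<noteq> x" "k \<noteq> n" using x by auto
    moreover from this have "entry p k \<in> {1..n}"
      using bij_betwE[OF permutation_entry_bij[OF p]] by blast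
    ultimately have "entry p k \<le> n" "entry p k \<noteq> n - 1" "entry p k \<noteq> n"
      using inj_on_eq_iff[OF bij_betw_imp_inj_on[OF permutation_entry_bij[OF p]], of k x]
        inj_on_eq_iff[OF bij_betw_imp_inj_on[OF permutation_entry_bij[OF p]], of k n]
        x last_entry by simp_all
    with x show "entry p k < entry p x" by simp
  qed
  then have x_lr: "x \<in> lr_positions p" using x len by (simp add: lr_positions_def)
  then obtain j where j: "j \<le> ell p" "x = lr_list p ! j" using lr_positions_image by auto
  with xn lr_list_0 have "1 \<le> j" by (cases j) auto
  then have "x \<le> lr_list p ! 1"
    using lr_list_less[of 1 j p] j length_lr_list[OF nonempty] by (cases "j = 1") auto
  then have "entry p x \<le> entry p (lr_list p ! 1)"
    using lr_max_ge[OF lr_list_in[OF assms], of x] x by simp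
  moreover have "entry p (lr_list p ! 1) < entry p n"
    using lr_max_mono[OF lr_list_in[OF assms] last] lr_list_less[of 0 1 p] lr_list_0
      length_lr_list[OF nonempty] assms by simp
  ultimately show ?thesis using x last_entry by simp
qed

text \<open>The height of \<open>R p (i + 1)\<close>.\<close>

private definition lower_value :: "nat \<Rightarrow> nat" where
  "lower_value i = (if i < ell p then entry p (lr_list p ! Suc i) else 0)"

private lemma gam'_eq:
  assumes "i \<in> {1..ell p}"
  shows "gam' p i = lower_value (i - 1) - lower_value i - 1"
proof -
  have "snd (R p i) = real (lower_value (i - 1))"
    using assms by (auto simp: R_eq nonempty plot_point_def lower_value_def)
  moreover have "snd (R p (i + 1)) = real (lower_value i)"
    using assms R_last[OF nonempty]
    by (cases "i = ell p") (auto simp: R_eq nonempty plot_point_def lower_value_def)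
  moreover have "lower_value (i - 1) \<le> n"
    using bij_betwE[OF permutation_entry_bij[OF p]] lr_list_in[of i] assms len
    by (auto simp: lower_value_def lr_positions_def)
  ultimately show ?thesis
    using card_points_between_heights[OF p] by (simp add: gam'_def)
qed

private lemma lower_value_antimono: "strict_antimono_on {..ell p} lower_value"
proof (rule monotone_onI)
  fix i j assume ij: "i \<in> {..ell p}" "j \<in> {..ell p}" "i < j"
  have "1 \<le> entry p (lr_list p ! Suc i)"
    using bij_betwE[OF permutation_entry_bij[OF p]] lr_list_in[of "Suc i"] ij len
    by (auto simp: lr_positions_def)
  moreover have "entry p (lr_list p ! Suc j) < entry p (lr_list p ! Suc i)" if "j < ell p"
    using lr_max_mono[OF lr_list_in[of "Suc j"] lr_list_in[of "Suc i"]] that ij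
      lr_list_less[of "Suc i" "Suc j" p] length_lr_list[OF nonempty] by simp
  ultimately show "lower_value j < lower_value i"
    using ij by (auto simp: lower_value_def)
qed

private lemma lower_value_image: "lower_value ` {..<ell p} = lr_values p - {n}"
proof -
  have "{..ell p} = insert 0 (Suc ` {..<ell p})"
    by (simp add: lessThan_Suc_atMost[symmetric] lessThan_Suc_eq_insert_0)
  then have "lr_values p = insert n (lower_value ` {..<ell p})"
    unfolding lr_values_def lr_positions_image
    by (simp add: image_image lower_value_def lr_list_0 last_entry)
  moreover have "n \<notin> lower_value ` {..<ell p}"
  proof
    assume "n \<in> lower_value ` {..<ell p}"
    then obtain i where i: "i < ell p" "entry p (lr_list p ! Suc i) = n"
      by (auto simp: lower_value_def)
    then have "entry p (lr_list p ! Suc i) < entry p n"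
      using lr_max_mono[OF lr_list_in[of "Suc i"] last] lr_list_less[of 0 "Suc i" p] lr_list_0
        length_lr_list[OF nonempty] by simp
    with i last_entry show False by simp
  qed
  ultimately show ?thesis by auto
qed

text \<open>The exponents are gaps between consecutive terms of the decreasing sequences
  \<open>lr_list\<close> and \<open>lower_value\<close>, so \<open>D_positions_path_word\<close>
  locates the \<open>D\<close>s. The second word is described only by its \<open>D\<close>s and by
  \<open>nonD\<close>, since its letters \<open>U\<close> and \<open>E\<close> come from positions,
  not from heights; \<open>word_eqI\<close> recovers it from this.\<close>

lemma LL_words:
  shows "fst (LL (p, Hs)) = position_word n (lr_positions p) (snd ` set Hs)" (is ?first)
    and "map (\<lambda>x. x = D) (snd (LL (p, Hs))) = map (\<lambda>x. x \<notin> lr_values p) (rev [1..<n])" (is ?second)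
    and "nonD (snd (LL (p, Hs))) = nonD (fst (LL (p, Hs)))" (is ?third)
proof -
  let ?js = "[1..<ell p + 1]" and ?X = "X_letter p Hs"
  have w: "fst (LL (p, Hs)) =
      path_word (map ?X ?js) (map (\<lambda>i. lr_list p ! (i - 1) - lr_list p ! i - 1) ?js)"
  proof -
    have "map (gam p) ?js = map (\<lambda>i. lr_list p ! (i - 1) - lr_list p ! i - 1) ?js"
      by (rule map_cong) (auto simp: gam_eq[OF nonempty])
    then show ?thesis by (simp only: LL_def Let_def prod.case fst_conv)
  qed
  have w': "snd (LL (p, Hs)) =
      path_word (map ?X ?js) (map (\<lambda>i. lower_value (i - 1) - lower_value i - 1) ?js)"
  proof -
    have "map (gam' p) ?js = map (\<lambda>i. lower_value (i - 1) - lower_value i - 1) ?js"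
      by (rule map_cong) (auto simp: gam'_eq)
    then show ?thesis by (simp only: LL_def Let_def prod.case snd_conv)
  qed
  have X: "?X i \<noteq> D" for i by (simp add: X_letter_def)
  then have notD: "D \<notin> set (map ?X ?js)" by (metis ex_map_conv)
  have nonD: "nonD (fst (LL (p, Hs))) = map ?X ?js" "nonD (snd (LL (p, Hs))) = map ?X ?js"
    unfolding w w' by (rule nonD_path_word; use notD in simp)+
  then show ?third by simp
  have "strict_antimono_on {..ell p} ((!) (lr_list p))"
    using lr_list_less[of _ _ p] length_lr_list[OF nonempty] by (auto simp: monotone_on_def)
  then have "map (\<lambda>x. x = D) (fst (LL (p, Hs))) =
      map (\<lambda>x. x \<notin> (!) (lr_list p) ` {..<ell p}) (rev [2..<n + 1])"
    unfolding w using X by (subst D_positions_path_word) (simp_all add: lr_list_0 lr_list_last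
        numeral_2_eq_2)
  also have "\<dots> = map (\<lambda>x. x \<notin> lr_positions p) (rev [2..<n + 1])"
  proof (rule map_cong)
    have "lr_positions p = insert 1 ((!) (lr_list p) ` {..<ell p})"
      unfolding lr_positions_image by (simp add: lr_list_last lessThan_Suc flip: lessThan_Suc_atMost)
    then show "(x \<notin> (!) (lr_list p) ` {..<ell p}) = (x \<notin> lr_positions p)"
      if "x \<in> set (rev [2..<n + 1])" for x
      using that by auto
  qed simp
  also have "\<dots> = map (\<lambda>x. x = D) (position_word n (lr_positions p) (snd ` set Hs))"
    by (simp add: position_word_def)
  finally have Dpos: "map (\<lambda>x. x = D) (fst (LL (p, Hs))) =
    map (\<lambda>x. x = D) (position_word n (lr_positions p) (snd ` set Hs))" .
  have letter: "?X j = (if lr_list p ! (j - 1) \<in> snd ` set Hs then U else E)"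
    if "j \<in> {1..ell p}" for j
    using that by (auto simp: X_letter_def R_eq nonempty northeast_def intro: rev_image_eqI)
  have "nonD (position_word n (lr_positions p) (snd ` set Hs)) =
      map (\<lambda>x. if x \<in> snd ` set Hs then U else E)
        (filter (\<lambda>x. x \<in> lr_positions p) (rev [2..<n + 1]))"
    unfolding position_word_def filter_map
    by (rule map_cong[OF filter_cong]) auto
  \<comment> \<open>The letter \<open>X_letter p Hs j\<close> belongs to the record with index
    \<open>j - 1\<close>, so the last record, at position 1, has none.\<close>
  also have "filter (\<lambda>x. x \<in> lr_positions p) (rev [2..<n + 1]) = butlast (lr_list p)"
  proof -
    have "[1..<n + 1] = 1 # [2..<n + 1]"
      using upt_conv_Cons[of 1 "n + 1"] len nonempty by (cases n) (auto simp: numeral_2_eq_2)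
    moreover have "filter (is_lr_max p) [1..<n + 1] = filter (\<lambda>x. x \<in> lr_positions p) [1..<n + 1]"
      by (rule filter_cong) (auto simp: lr_positions_def len)
    ultimately have "lr_list p = filter (\<lambda>x. x \<in> lr_positions p) (rev [2..<n + 1]) @ [1]"
      using one_in_lr_positions[OF nonempty] by (simp add: lr_list_def len rev_filter)
    then show ?thesis by simp
  qed
  also have "\<dots> = map (\<lambda>j. lr_list p ! (j - 1)) ?js"
    by (rule nth_equalityI) (auto simp: length_lr_list[OF nonempty] nth_butlast)
  also have "map (\<lambda>x. if x \<in> snd ` set Hs then U else E) \<dots> = map ?X ?js"
    unfolding map_map o_def by (rule map_cong) (auto simp: letter)
  finally have "nonD (position_word n (lr_positions p) (snd ` set Hs)) = map ?X ?js" .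
  then show ?first
    by (intro word_eqI[OF _ Dpos] trans[OF nonD(1)]) (rule sym)
  have "map (\<lambda>x. x = D) (snd (LL (p, Hs))) =
      map (\<lambda>x. x \<notin> lr_values p - {n}) (rev [lower_value (ell p) + 1..<lower_value 0 + 1])"
    unfolding w' using X lower_value_antimono
    by (subst D_positions_path_word) (simp_all add: lower_value_image)
  \<comment> \<open>The top height is that of \<open>R p 1\<close>, namely \<open>n - 1\<close>. If
    \<open>ell p = 0\<close>, then \<open>n = 1\<close> and both ranges are empty.\<close>
  also have "[lower_value (ell p) + 1..<lower_value 0 + 1] = [1..<n]"
  proof (cases "ell p")
    case 0
    then have "n = 1" using lr_list_0 lr_list_last by simp
    with 0 show ?thesis by (simp add: lower_value_def)
  next
    case (Suc l)
    have "Suc (n - Suc 0) = n" using len nonempty by (cases n) auto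
    with Suc second_value show ?thesis by (simp add: lower_value_def)
  qed
  finally show ?second by (auto simp: map_eq_conv)
qed

end

subsection \<open>The bijection\<close>

lemma position_word_inj:
  assumes "position_word n A S = position_word n A' S'" "x \<in> {2..n}"
  shows "x \<in> A \<longleftrightarrow> x \<in> A'" "x \<in> A \<Longrightarrow> x \<in> S \<longleftrightarrow> x \<in> S'"
proof -
  have "x \<in> set (rev [2..<n + 1])" using assms(2) by auto
  with assms(1) have "(if x \<notin> A then D else if x \<in> S then U else E) =
      (if x \<notin> A' then D else if x \<in> S' then U else E)"
    unfolding position_word_def map_eq_conv by blast
  then show "x \<in> A \<longleftrightarrow> x \<in> A'" "x \<in> A \<Longrightarrow> x \<in> S \<longleftrightarrow> x \<in> S'"
    by (auto split: if_splits)
qed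
lemma VHC_Av_312E:
  assumes "n \<ge> 1" "x \<in> VHC (Av n {[3, 1, 2]})"
  obtains p f where "x = (p, map (\<lambda>d. (d, f d)) (descents p))"
    "p \<in> permutations_of_set {1..n}" "avoids_312 p"
    "matching (set (descents p)) (lr_positions p) f" "n \<in> lr_positions p"
proof -
  obtain p Hs where "x = (p, Hs)" "p \<in> Av n {[3, 1, 2]}" "is_vhc p Hs"
    using assms(2) unfolding VHC_def VHC_perm_def by blast
  then have x: "x = (p, Hs)" "p \<in> permutations_of_set {1..n}" "avoids_312 p" "is_vhc p Hs"
    unfolding Av_312_iff by blast+
  have dist: "distinct p" using x(2) by (rule permutations_of_setD)
  have len: "length p = n" using x(2) by (rule permutation_length)
  obtain f where f: "matching (set (descents p)) (lr_positions p) f"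
    "Hs = map (\<lambda>d. (d, f d)) (descents p)"
    using is_vhc_imp_matching[OF x(3) dist x(4)] by blast
  have "n \<in> lr_positions p"
    using matching_last_lr_position[OF x(3) dist _ f(1)] assms(1) len by fastforce
  with that x f show ?thesis by blast
qed

lemma descents_set:
  assumes "p \<in> permutations_of_set {1..n}" "avoids_312 p"
  shows "set (descents p) = {d. 1 \<le> d \<and> d < n \<and> d + 1 \<notin> lr_positions p}"
  using descent_iff[OF assms(2)] permutations_of_setD(2)[OF assms(1)]
    permutation_length[OF assms(1)] by auto

lemma matching_image_subset:
  assumes "matching (set (descents p)) (lr_positions p) f"
  shows "f ` set (descents p) \<subseteq> lr_positions p \<inter> {2..length p}"
proof
  fix s assume "s \<in> f ` set (descents p)"
  then obtain d where d: "d \<in> set (descents p)" "s = f d" by blast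
  then have "1 \<le> d" "d < s" "s \<in> lr_positions p"
    using assms by (auto simp: matching_def descents_def)
  then show "s \<in> lr_positions p \<inter> {2..length p}"
    by (auto simp: lr_positions_def)
qed

lemma LL_in_motzkin_C:
  assumes n: "n \<ge> 1" and x: "x \<in> VHC (Av n {[3, 1, 2]})"
  shows "LL x \<in> motzkin_C (n - 1)"
proof -
  obtain p f where x_eq: "x = (p, map (\<lambda>d. (d, f d)) (descents p))"
    and p: "p \<in> permutations_of_set {1..n}" and av: "avoids_312 p"
    and f: "matching (set (descents p)) (lr_positions p) f" and last: "n \<in> lr_positions p"
    using VHC_Av_312E[OF n x] by metis
  let ?Ds = "set (descents p)" and ?A = "lr_positions p" and ?V = "lr_values p"
  have hooks: "snd ` set (map (\<lambda>d. (d, f d)) (descents p)) = f ` ?Ds"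
    by (simp add: image_image)
  note words = LL_words[OF p last, of "map (\<lambda>d. (d, f d)) (descents p)",
      unfolded hooks, folded x_eq]
  have A: "?A \<subseteq> {1..n}"
    using permutation_length[OF p] by (auto simp: lr_positions_def)
  have sub: "f ` ?Ds \<subseteq> ?A \<inter> {2..n}"
    using matching_image_subset[OF f] permutation_length[OF p] by simp
  have "card ?Ds = card (f ` ?Ds)"
    using f by (simp add: matching_def card_image)
  then have "position_word n ?A (f ` ?Ds) \<in> motzkin (n - 1)"
    using position_word_motzkin_iff[OF n sub, folded descents_set[OF p av]] matching_ballot[OF f]
    by simp
  then have "fst (LL x) \<in> motzkin (n - 1)" by (simp add: words)
  moreover have "length (snd (LL x)) = n - 1"
    using arg_cong[OF words(2), of length] by simp
  moreover have "\<forall>i\<le>n - 1. length (nonD (take i (fst (LL x)))) \<le> length (nonD (take i (snd (LL x))))"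
  proof (subst nonD_prefixes_iff_dominance[OF _ words(2) A lr_values_subset[OF p last]
        n_in_lr_values[OF p last]])
    show "map (\<lambda>x. x = D) (fst (LL x)) = map (\<lambda>x. x \<notin> ?A) (rev [2..<n + 1])"
      by (simp add: words(1) position_word_def)
  qed (use lr_dominance[OF p] in \<open>auto simp: card_lr_values\<close>)
  ultimately have "(fst (LL x), snd (LL x)) \<in> motzkin_C (n - 1)"
    unfolding motzkin_C_iff using words(3) by simp
  then show ?thesis by simp
qed

text \<open>The first word returns the record positions and the image of the matching, the second
  the record values below \<open>n\<close>; position 1 and value \<open>n\<close> are always
  present. Uniqueness of the permutation and of the matching finishes the argument.\<close>

lemma LL_inj:
  assumes n: "n \<ge> 1" and x: "x \<in> VHC (Av n {[3, 1, 2]})" and y: "y \<in> VHC (Av n {[3, 1, 2]})"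
    and eq: "LL x = LL y"
  shows "x = y"
proof -
  obtain p f where x_eq: "x = (p, map (\<lambda>d. (d, f d)) (descents p))"
    and p: "p \<in> permutations_of_set {1..n}" and av: "avoids_312 p"
    and f: "matching (set (descents p)) (lr_positions p) f" and last: "n \<in> lr_positions p"
    using VHC_Av_312E[OF n x] by metis
  obtain q g where y_eq: "y = (q, map (\<lambda>d. (d, g d)) (descents q))"
    and q: "q \<in> permutations_of_set {1..n}" and av': "avoids_312 q"
    and g: "matching (set (descents q)) (lr_positions q) g" and last': "n \<in> lr_positions q"
    using VHC_Av_312E[OF n y] by metis
  have hooks: "snd ` set (map (\<lambda>d. (d, h d)) (descents r)) = h ` set (descents r)" for h :: "nat \<Rightarrow> nat" and r
    by (simp add: image_image)
  note words = LL_words[OF p last, of "map (\<lambda>d. (d, f d)) (descents p)",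
      unfolded hooks, folded x_eq]
  note words' = LL_words[OF q last', of "map (\<lambda>d. (d, g d)) (descents q)",
      unfolded hooks, folded y_eq]
  have len: "length p = n" "length q = n" using p q by (simp_all add: permutation_length)
  have pw: "position_word n (lr_positions p) (f ` set (descents p)) =
      position_word n (lr_positions q) (g ` set (descents q))"
    using words(1) words'(1) eq by simp
  have "1 \<in> lr_positions p" "1 \<in> lr_positions q"
    using one_in_lr_positions[of p] one_in_lr_positions[of q] len n by fastforce+
  moreover have "lr_positions p \<subseteq> {1..n}" "lr_positions q \<subseteq> {1..n}"
    using len by (auto simp: lr_positions_def)
  moreover have "{1..n} = insert 1 {2..n}" using n by auto
  ultimately have "x \<in> lr_positions p \<longleftrightarrow> x \<in> lr_positions q" for x
    using position_word_inj(1)[OF pw, of x] by (cases "x = 1") auto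
  then have pos: "lr_positions p = lr_positions q" by blast
  have "\<forall>h\<in>{1..<n}. h \<in> lr_values p \<longleftrightarrow> h \<in> lr_values q"
    using words(2) words'(2) eq by (simp add: map_eq_conv)
  then have "h \<in> lr_values p \<longleftrightarrow> h \<in> lr_values q" for h
    using n_in_lr_values[OF p last] n_in_lr_values[OF q last']
      subsetD[OF lr_values_subset[OF p last], of h] subsetD[OF lr_values_subset[OF q last'], of h]
    by (cases "h = n") auto
  then have val: "lr_values p = lr_values q" by blast
  have pq: "p = q"
    using permutation_determined[OF p av q av' pos val] .
  have sub: "f ` set (descents p) \<subseteq> lr_positions p \<inter> {2..n}"
    "g ` set (descents p) \<subseteq> lr_positions p \<inter> {2..n}"
    using matching_image_subset[OF f] matching_image_subset[OF g] len pq by simp_all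
  have "f ` set (descents p) = g ` set (descents p)"
  proof (rule set_eqI)
    fix s show "s \<in> f ` set (descents p) \<longleftrightarrow> s \<in> g ` set (descents p)"
      using sub position_word_inj(2)[OF pw, of s] unfolding pq by blast
  qed
  then have "f d = g d" if "d \<in> set (descents p)" for d
    using matching_unique[OF f] g that unfolding pq by blast
  then show ?thesis using x_eq y_eq pq by simp
qed

text \<open>The hypotheses separate: the order relation is dominance for \<open>(A, V)\<close> and
  yields the permutation, while \<open>w\<close> being Motzkin is the ballot condition for
  \<open>S\<close> and yields the hooks.\<close>

lemma LL_surj:
  assumes n: "n \<ge> 1" and ww': "(w, w') \<in> motzkin_C (n - 1)"
  shows "\<exists>x\<in>VHC (Av n {[3, 1, 2]}). LL x = (w, w')"
proof -
  have w: "w \<in> motzkin (n - 1)" and len: "length w = n - 1" "length w' = n - 1"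
    and nonD_eq: "nonD w = nonD w'"
    and le: "\<forall>i\<le>n - 1. length (nonD (take i w)) \<le> length (nonD (take i w'))"
    using ww' unfolding motzkin_C_iff by (auto simp: motzkin_def)
  \<comment> \<open>Letter \<open>n - x\<close> of \<open>w\<close> (counted from 0) belongs to
    position \<open>x\<close>, letter \<open>n - 1 - h\<close> of \<open>w'\<close> to height
    \<open>h\<close>. Position 1 and height \<open>n\<close>, which have no letter, are
    adjoined.\<close>
  define A where "A = insert 1 {x \<in> {2..n}. w ! (n - x) \<noteq> D}"
  define V where "V = insert n {h \<in> {1..<n}. w' ! (n - 1 - h) \<noteq> D}"
  define S where "S = {x \<in> {2..n}. w ! (n - x) = U}"
  have A: "A \<subseteq> {1..n}" "1 \<in> A" and V: "V \<subseteq> {1..n}" "n \<in> V" and S: "S \<subseteq> A \<inter> {2..n}"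
    using n by (auto simp: A_def V_def S_def)
  have w_eq: "w = position_word n A S"
  proof (rule nth_equalityI)
    fix i assume i: "i < length w"
    have "rev [2..<n + 1] ! i = n - i"
      using i len by (auto simp: rev_nth)
    then have "position_word n A S ! i = (if n - i \<notin> A then D else if n - i \<in> S then U else E)"
      using i len by (simp add: position_word_def)
    moreover have "n - i \<in> {2..n}" "n - (n - i) = i" using i len by auto
    ultimately show "w ! i = position_word n A S ! i"
      by (cases "w ! i") (auto simp: A_def S_def)
  qed (simp add: len position_word_def)
  have w'_pos: "map (\<lambda>x. x = D) w' = map (\<lambda>x. x \<notin> V) (rev [1..<n])"
  proof (rule nth_equalityI)
    fix i assume i: "i < length (map (\<lambda>x. x = D) w')"
    have "rev [1..<n] ! i = n - Suc i" using i len by (auto simp: rev_nth)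
    moreover have "n - Suc i \<in> {1..<n}" "n - 1 - (n - Suc i) = i" using i len by auto
    ultimately show "map (\<lambda>x. x = D) w' ! i = map (\<lambda>x. x \<notin> V) (rev [1..<n]) ! i"
      using i len by (auto simp: V_def)
  qed (simp add: len)
  have w_pos: "map (\<lambda>x. x = D) w = map (\<lambda>x. x \<notin> A) (rev [2..<n + 1])"
    by (simp add: w_eq position_word_def)
  have "card A = Suc (length (nonD w))"
  proof -
    have "A = insert 1 {x \<in> {2..<n + 1}. x \<in> A}" using A by (auto simp: le_Suc_eq)
    then have "card A = Suc (card {x \<in> {2..<n + 1}. x \<in> A})"
      using card_insert_disjoint[of "{x \<in> {2..<n + 1}. x \<in> A}" 1] by simp
    then show ?thesis
      unfolding length_nonD_positions[OF w_pos] by (simp only: length_filter_rev_upt)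
  qed
  moreover have "card V = Suc (length (nonD w'))"
  proof -
    have "V = insert n {h \<in> {1..<n}. h \<in> V}" using V by auto
    then have "card V = Suc (card {h \<in> {1..<n}. h \<in> V})"
      using card_insert_disjoint[of "{h \<in> {1..<n}. h \<in> V}" n] by simp
    then show ?thesis
      unfolding length_nonD_positions[OF w'_pos] by (simp only: length_filter_rev_upt)
  qed
  ultimately have card: "card A = card V" using nonD_eq by simp
  have dom: "\<forall>k\<in>{1..n}. card (V \<inter> {..<k}) < card (A \<inter> {..k})"
    using nonD_prefixes_iff_dominance[OF w_pos w'_pos A(1) V card] le by simp
  obtain p where p: "p \<in> permutations_of_set {1..n}" and av: "avoids_312 p"
    and pA: "lr_positions p = A" and pV: "lr_values p = V"
    using exists_permutation[OF V(1) A card] dom by blast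
  let ?Ds = "set (descents p)"
  have Ds: "?Ds = {d. 1 \<le> d \<and> d < n \<and> d + 1 \<notin> A}"
    using descents_set[OF p av] pA by simp
  have ballot: "card ?Ds = card S"
    "\<And>k. k \<in> {1..n} \<Longrightarrow> card {d \<in> ?Ds. k \<le> d} \<le> card {s \<in> S. k < s}"
    using w[unfolded w_eq position_word_motzkin_iff[OF n S]] Ds by simp_all
  have "finite S" by (simp add: S_def)
  then obtain f where f: "matching ?Ds S f" "f ` ?Ds = S"
  proof (rule matching_exists[OF finite_set _ ballot(1)])
    show "card {e \<in> ?Ds. d \<le> e} \<le> card {s \<in> S. d < s}" if "d \<in> ?Ds" for d
      using that ballot(2)[of d] Ds by simp
  qed
  then have f_lr: "matching ?Ds (lr_positions p) f"
    using S pA by (auto simp: matching_def)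
  have last: "n \<in> lr_positions p"
    using matching_last_lr_position[OF av permutations_of_setD(2)[OF p] _ f_lr]
      permutation_length[OF p] n by fastforce
  let ?Hs = "map (\<lambda>d. (d, f d)) (descents p)"
  have "is_vhc p ?Hs" using f_lr by (rule matching_imp_is_vhc)
  then have x: "(p, ?Hs) \<in> VHC (Av n {[3, 1, 2]})"
    using p av unfolding VHC_def VHC_perm_def by (simp add: Av_312_iff[simplified])
  have hooks: "snd ` set ?Hs = S" using f(2) by (simp add: image_image)
  note words = LL_words[OF p last, of ?Hs, unfolded hooks pA pV]
  have fst: "fst (LL (p, ?Hs)) = w"
    using words(1) w_eq by simp
  moreover have "snd (LL (p, ?Hs)) = w'"
  proof (rule word_eqI)
    show "nonD (snd (LL (p, ?Hs))) = nonD w'" unfolding words(3) fst nonD_eq ..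
    show "map (\<lambda>x. x = D) (snd (LL (p, ?Hs))) = map (\<lambda>x. x = D) w'"
      unfolding words(2) w'_pos ..
  qed
  ultimately have "LL (p, ?Hs) = (w, w')" by (rule prod_eqI[of _ "(w, w')", unfolded fst_conv snd_conv])
  with x show ?thesis by blast
qed

theorem theorem2:
  fixes n :: nat
  assumes "n \<ge> 1"
  shows "LL ` VHC (Av n {[3, 1, 2]}) \<subseteq> intervals (motzkin (n - 1)) (motzkin_C (n - 1))
       \<and> bij_betw LL (VHC (Av n {[3, 1, 2]})) (intervals (motzkin (n - 1)) (motzkin_C (n - 1)))
       \<and> card (VHC (Av n {[3, 1, 2]})) = card (intervals (motzkin (n - 1)) (motzkin_C (n - 1)))"
proof -
  have "inj_on LL (VHC (Av n {[3, 1, 2]}))"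
    using LL_inj[OF assms] by (intro inj_onI)
  moreover have "LL ` VHC (Av n {[3, 1, 2]}) = motzkin_C (n - 1)"
  proof
    show "LL ` VHC (Av n {[3, 1, 2]}) \<subseteq> motzkin_C (n - 1)"
      using LL_in_motzkin_C[OF assms] by blast
    show "motzkin_C (n - 1) \<subseteq> LL ` VHC (Av n {[3, 1, 2]})"
      using LL_surj[OF assms] by (force simp: image_iff)
  qed
  ultimately have "bij_betw LL (VHC (Av n {[3, 1, 2]})) (motzkin_C (n - 1))"
    by (simp add: bij_betw_def)
  then show ?thesis
    unfolding intervals_motzkin_C
    using bij_betw_same_card bij_betw_imp_surj_on by blast
qed

end
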